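(* Let $F$ be a Banach lattice, $E$ a Banach space and $T\in\mathcal{L}(F,E)$. The following are equivalent: (i) there is no disjoint sequence $(f_n)\subset\mathrm{S}_F$ with $\|Tf_n\|\to0$ (equivalently, no almost disjoint sequence $(f_n)\subset\mathrm{S}_F$ with $\|Tf_n\|\to0$); (ii) for every disjoint sequence $(f_n)$ of nonzero elements of $F$, the restriction of $T$ to $\overline{\mathrm{span}}\{f_n\}$ is not compact; (iii) for every such $(f_n)$, the restriction of $T$ to $\overline{\mathrm{span}}\{f_n\}$ is not strictly singular; (iv) for every such $(f_n)$, the restriction of $T$ to $\overline{\mathrm{span}}\{f_n\}$ is upper semi-Fredholm; (v) for every such $(f_n)$ there is $m\in\mathbb{N}$ such that $T$ is bounded from below on $\overline{\mathrm{span}}\{f_n\}_{n\ge m}$; (vi) $\ker(T-S)$ is dispersed for every compact operator $S:F\to E$; (vii) the restriction of $T$ to every anti-dispersed closed subspace of $F$ is upper semi-Fredholm; (viii) no restriction of $T$ to a non-dispersed closed subspace of $F$ is compact; (ix) no restriction of $T$ to a non-dispersed closed subspace of $F$ is strictly singular. An operator satisfying these conditions is called disjointly non-singular (DNS).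
   Context: $\mathrm{S}_X$ is the unit sphere. $x,y$ are disjoint if $|x|\wedge|y|=0$. A sequence $(e_n)$ in the unit sphere of a subspace $G$ is almost disjoint if there is a disjoint $(g_n)\subset F$ with $\|g_n-e_n\|\to0$. A subspace is dispersed if it contains no almost disjoint sequence; a closed subspace is anti-dispersed if it contains no infinite-dimensional closed dispersed subspace. An operator is upper semi-Fredholm if it has finite-dimensional kernel and closed range; strictly singular if no restriction to an infinite-dimensional subspace is bounded from below. *)

theory Defs
  imports "HOL-Analysis.Analysis"
begin

class banach_lattice = banach + ordered_real_vector + lattice +
  assumes lattice_norm_mono:
    "sup x (- x) \<le> sup y (- y) \<Longrightarrow> norm x \<le> norm y"

definition lmod :: "'f::banach_lattice \<Rightarrow> 'f" where
  "lmod x = sup x (- x)"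

definition ldisjoint :: "'f::banach_lattice \<Rightarrow> 'f \<Rightarrow> bool" where
  "ldisjoint x y \<longleftrightarrow> inf (lmod x) (lmod y) = 0"

definition disjoint_seq :: "(nat \<Rightarrow> 'f::banach_lattice) \<Rightarrow> bool" where
  "disjoint_seq g \<longleftrightarrow> (\<forall>m n. m \<noteq> n \<longrightarrow> ldisjoint (g m) (g n))"

definition almost_disjoint_in :: "'f::banach_lattice set \<Rightarrow> (nat \<Rightarrow> 'f) \<Rightarrow> bool" where
  "almost_disjoint_in G e \<longleftrightarrow>
     (\<forall>n. e n \<in> G \<and> norm (e n) = 1) \<and>
     (\<exists>g. disjoint_seq g \<and> (\<lambda>n. norm (g n - e n)) \<longlonglongrightarrow> 0)"

definition dispersed :: "'f::banach_lattice set \<Rightarrow> bool" where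
  "dispersed G \<longleftrightarrow> \<not> (\<exists>e. almost_disjoint_in G e)"

definition closed_subspace :: "'a::real_normed_vector set \<Rightarrow> bool" where
  "closed_subspace G \<longleftrightarrow> subspace G \<and> closed G"

definition fin_dim :: "'a::real_vector set \<Rightarrow> bool" where
  "fin_dim H \<longleftrightarrow> (\<exists>B. finite B \<and> H \<subseteq> span B)"

definition anti_dispersed :: "'f::banach_lattice set \<Rightarrow> bool" where
  "anti_dispersed G \<longleftrightarrow> closed_subspace G \<and>
     \<not> (\<exists>H. closed_subspace H \<and> H \<subseteq> G \<and> \<not> fin_dim H \<and> dispersed H)"

definition bounded_below_on :: "'a::real_normed_vector set \<Rightarrow> ('a \<Rightarrow> 'b::real_normed_vector) \<Rightarrow> bool" where
  "bounded_below_on G T \<longleftrightarrow> (\<exists>c>0. \<forall>x\<in>G. c * norm x \<le> norm (T x))"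

definition compact_on :: "'a::real_normed_vector set \<Rightarrow> ('a \<Rightarrow> 'b::real_normed_vector) \<Rightarrow> bool" where
  "compact_on G T \<longleftrightarrow> compact (closure (T ` (G \<inter> cball 0 1)))"

definition strictly_singular_on :: "'a::real_normed_vector set \<Rightarrow> ('a \<Rightarrow> 'b::real_normed_vector) \<Rightarrow> bool" where
  "strictly_singular_on G T \<longleftrightarrow>
     \<not> (\<exists>H. subspace H \<and> H \<subseteq> G \<and> \<not> fin_dim H \<and> bounded_below_on H T)"

definition upper_semi_fredholm_on :: "'a::real_normed_vector set \<Rightarrow> ('a \<Rightarrow> 'b::real_normed_vector) \<Rightarrow> bool" where
  "upper_semi_fredholm_on G T \<longleftrightarrow> fin_dim {x\<in>G. T x = 0} \<and> closed (T ` G)"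

end

theory Submission
  imports Defs "HOL-Library.Lattice_Algebras"
begin

text \<open>
  The equivalences rest on three constructions. A gliding hump shows that every infinite-dimensional
  closed subspace of the closed span of a disjoint sequence contains an almost disjoint sequence, and
  that an operator satisfying (i) is bounded from below on some tail of such a span; perturbing that
  tail yields (ix). If (i) fails, a disjoint normalised sequence with summable images makes the operator
  compact on its closed span and equal there to a compact operator defined on the whole space by means
  of Hahn--Banach extensions of the coordinate functionals; a compact operator with closed range has
  finite rank by Baire and Riesz, so (iv) fails as well. Finally, an operator that is not upper
  semi-Fredholm on a closed subspace is compact on an infinite-dimensional closed subspace of it
  (Kato), which is what connects (vii) with (viii).
\<close>

text \<open>No theory of basic sequences is used. In its place stands one kind of estimate,
  \<open>\<bar>a k\<bar> \<le> C k * norm (\<Sum>j<N. a j *\<^sub>R x j)\<close>: it yields linear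
  independence, compactness of \<open>T\<close> on the closed span, and for disjoint sequences also
  the coordinate functionals and stability under small perturbations. For normalised disjoint
  vectors it holds with constant \<open>C\<close>, by monotonicity of the lattice norm; for Kato's
  vectors it holds with \<open>C k = 2 ^ k\<close>. Two obstacles shape the argument. Vectors found
  inside a given subspace are in general only almost disjoint, so (i) has to be transferred to such
  sequences, and (ix) needs a perturbation whose size is adapted to \<open>T\<close>. Moreover
  \<open>T\<close> may have a nonzero finite-dimensional kernel on the span of a disjoint sequence,
  so only a tail can be expected to be bounded from below. Moving between a span and its tails
  requires that finite-dimensional changes preserve closedness and infinite dimension, which is why
  the linear algebra comes first.\<close>

section \<open>Recursive choice of sequences\<close>

text \<open>The list \<open>L n\<close> records the history, so each choice may depend on all
  earlier values as a finite set. Constructions that must remember auxiliary data let the values be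
  tuples.\<close>

lemma sequence_choice:
  assumes "\<And>n A. finite A \<Longrightarrow> \<exists>y::'a. P n A y"
  obtains f :: "nat \<Rightarrow> 'a" where "\<And>n. P n (f ` {..<n}) (f n)"
proof -
  define L where "L = rec_nat [] (\<lambda>n l. (SOME y. P n (set l) y) # l)"
  define f where "f n = hd (L (Suc n))" for n
  have f: "f n = (SOME y. P n (set (L n)) y)" for n
    by (simp add: f_def L_def)
  have "L (Suc n) = f n # L n" for n
    by (simp add: f_def L_def)
  moreover have "L 0 = []" by (simp add: L_def)
  ultimately have "set (L n) = f ` {..<n}" for n
    by (induction n) (simp_all add: lessThan_Suc)
  moreover have "P n (set (L n)) (f n)" for n
    unfolding f by (rule someI_ex) (simp add: assms)
  ultimately show thesis
    using that[of f] by simp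
qed

lemma subseq_below:
  fixes a :: "nat \<Rightarrow> real"
  assumes "a \<longlonglongrightarrow> 0" and "\<And>n. 0 < d n"
  obtains r :: "nat \<Rightarrow> nat" where "strict_mono r" "\<And>n. a (r n) < d n"
proof -
  have ev: "\<exists>N>k. a N < d n" for k n
  proof -
    have "eventually (\<lambda>N. a N < d n) sequentially"
      using assms order_tendstoD(2) by blast
    then obtain M where "\<And>N. N \<ge> M \<Longrightarrow> a N < d n"
      by (auto simp: eventually_sequentially)
    then show ?thesis by (intro exI[of _ "max M (Suc k)"]) auto
  qed
  have "\<exists>r::nat \<Rightarrow> nat. \<forall>n. a (r n) < d n \<and> r n < r (Suc n)"
    by (intro dependent_nat_choice) (use ev in blast)+
  then show thesis
    using that by (metis strict_mono_Suc_iff)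
qed

section \<open>Finite-dimensional subspaces\<close>

text \<open>If \<open>b\<close> has positive distance \<open>d\<close> from \<open>span K\<close>,
  the coefficient of \<open>b\<close> is a Lipschitz function of the vector with constant
  \<open>1/d\<close>. Convergence of the vectors therefore forces convergence of their coefficients,
  and the remainder converges inside \<open>span K\<close>.\<close>

lemma closed_span_insert:
  fixes K :: "'a::real_normed_vector set"
  assumes "closed (span K)"
  shows "closed (span (insert b K))"
proof (cases "b \<in> span K")
  case True
  then show ?thesis using assms by (simp add: span_redundant)
next
  case False
  then obtain d where d: "d > 0" "\<And>y. y \<in> span K \<Longrightarrow> d \<le> dist b y"
  proof -
    obtain d where "d > 0" "ball b d \<subseteq> - span K"
      using False assms open_contains_ball[of "- span K"] unfolding closed_def by blast
    then show thesis
      by (intro that[of d]) (meson ComplD mem_ball not_less subsetD)+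
  qed
  have bound: "\<bar>k\<bar> * d \<le> norm (x + k *\<^sub>R b)" if "x \<in> span K" for x k
  proof (cases "k = 0")
    case False
    have "d \<le> dist b ((-1/k) *\<^sub>R x)"
      using that by (intro d span_scale)
    also have "\<dots> = norm (x + k *\<^sub>R b) / \<bar>k\<bar>"
    proof -
      have "b - (-1/k) *\<^sub>R x = (1/k) *\<^sub>R (x + k *\<^sub>R b)"
        using False by (simp add: scaleR_right_distrib)
      then show ?thesis by (simp add: dist_norm)
    qed
    finally show ?thesis using False by (simp add: field_simps)
  qed auto
  show ?thesis
    unfolding closed_sequential_limits
  proof safe
    fix x l assume x: "\<forall>n. x n \<in> span (insert b K)" and l: "x \<longlonglongrightarrow> l"
    have "\<forall>n. \<exists>k. x n - k *\<^sub>R b \<in> span K"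
      using x by (simp add: span_breakdown_eq)
    then obtain k where k: "\<And>n. x n - k n *\<^sub>R b \<in> span K" by metis
    have kb: "\<bar>k m - k n\<bar> * d \<le> dist (x m) (x n)" for m n
    proof -
      have "(x m - k m *\<^sub>R b) - (x n - k n *\<^sub>R b) \<in> span K"
        by (intro span_diff k)
      from bound[OF this, of "k m - k n"] show ?thesis
        by (simp add: dist_norm scaleR_left_diff_distrib)
    qed
    have "Cauchy k"
    proof (rule metric_CauchyI)
      fix e :: real assume "e > 0"
      moreover have "Cauchy x" using l LIMSEQ_imp_Cauchy by blast
      ultimately obtain M where M: "\<And>m n. m \<ge> M \<Longrightarrow> n \<ge> M \<Longrightarrow> dist (x m) (x n) < e * d"
        using d(1) metric_CauchyD[of x "e * d"] by auto
      have "dist (k m) (k n) < e" if "m \<ge> M" "n \<ge> M" for m n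
        using le_less_trans[OF kb M[OF that]] d(1) by (simp add: dist_real_def)
      then show "\<exists>M. \<forall>m\<ge>M. \<forall>n\<ge>M. dist (k m) (k n) < e" by blast
    qed
    then obtain c where "k \<longlonglongrightarrow> c"
      using Cauchy_convergent convergent_def by blast
    then have "(\<lambda>n. x n - k n *\<^sub>R b) \<longlonglongrightarrow> l - c *\<^sub>R b"
      using l by (intro tendsto_intros)
    then have "l - c *\<^sub>R b \<in> span K"
      by (rule closed_sequentially[OF assms, rotated]) (rule k)
    then show "l \<in> span (insert b K)"
      by (auto simp: span_breakdown_eq)
  qed
qed

lemma closed_span_Un_finite:
  fixes K :: "'a::real_normed_vector set"
  assumes "finite B" "closed (span K)"
  shows "closed (span (B \<union> K))"
  using assms by induction (auto intro: closed_span_insert)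

lemma fin_dim_subset: "fin_dim H \<Longrightarrow> G \<subseteq> H \<Longrightarrow> fin_dim G"
  unfolding fin_dim_def by blast

text \<open>The quotient of \<open>H\<close> by \<open>H \<inter> K\<close> embeds into that of
  \<open>span (B \<union> K)\<close> by \<open>K\<close>, which is finite-dimensional. The induction
  avoids quotients: each element of \<open>B\<close> costs at most one vector of
  \<open>H\<close>.\<close>

lemma finite_extension_over_Int:
  fixes H :: "'a::real_vector set"
  assumes "finite B" "subspace H" "subspace K" "H \<subseteq> span (B \<union> K)"
  shows "\<exists>C. finite C \<and> H \<subseteq> span (C \<union> (H \<inter> K))"
  using assms
proof (induction B arbitrary: H rule: finite_induct)
  case empty
  then have "H \<subseteq> K" by (simp add: span_eq_iff[THEN iffD2])
  then show ?case
    by (intro exI[of _ "{}"]) (auto intro: span_base)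
next
  case (insert b B)
  define H' where "H' = H \<inter> span (B \<union> K)"
  have "subspace H'"
    unfolding H'_def using insert by (intro subspace_inter subspace_span)
  then obtain C where C: "finite C" "H' \<subseteq> span (C \<union> (H' \<inter> K))"
    using insert.IH[of H'] insert.prems H'_def by blast
  moreover have "H' \<inter> K = H \<inter> K"
    unfolding H'_def by (auto intro: span_base)
  ultimately have H': "H' \<subseteq> span (C \<union> (H \<inter> K))" by simp
  show ?case
  proof (cases "H \<subseteq> H'")
    case True
    then show ?thesis using C H' by blast
  next
    case False
    then obtain h where h: "h \<in> H" "h \<notin> span (B \<union> K)" by (auto simp: H'_def)
    have split: "\<exists>k. x - k *\<^sub>R b \<in> span (B \<union> K)" if "x \<in> H" for x
      using that insert.prems(3) by (auto simp: span_breakdown_eq)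
    obtain s where s: "h - s *\<^sub>R b \<in> span (B \<union> K)" using split h by blast
    have "s \<noteq> 0" using s h by auto
    have "x \<in> span (insert h C \<union> (H \<inter> K))" if "x \<in> H" for x
    proof -
      obtain k where k: "x - k *\<^sub>R b \<in> span (B \<union> K)" using split[OF \<open>x \<in> H\<close>] by blast
      \<comment> \<open>The multiple \<open>k / s\<close> of \<open>h\<close> cancels the component
        of \<open>x\<close> along \<open>b\<close>.\<close>
      have "(x - k *\<^sub>R b) - (k / s) *\<^sub>R (h - s *\<^sub>R b) \<in> span (B \<union> K)"
        by (intro span_diff span_scale k s)
      moreover have "(x - k *\<^sub>R b) - (k / s) *\<^sub>R (h - s *\<^sub>R b) = x - (k / s) *\<^sub>R h"
        using \<open>s \<noteq> 0\<close> by (simp add: algebra_simps)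
      moreover have "x - (k / s) *\<^sub>R h \<in> H"
        using that h insert.prems by (intro subspace_diff subspace_scale) auto
      ultimately have "x - (k / s) *\<^sub>R h \<in> span (C \<union> (H \<inter> K))"
        using H' by (auto simp: H'_def)
      then show ?thesis by (auto simp: span_breakdown_eq)
    qed
    then show ?thesis
      using C(1) by (intro exI[of _ "insert h C"]) auto
  qed
qed

text \<open>Used mostly in contrapositive form: an infinite-dimensional \<open>H\<close> meets every
  subspace of finite codimension in an infinite-dimensional space.\<close>

lemma fin_dim_if_fin_dim_Int:
  fixes H :: "'a::real_vector set"
  assumes "finite B" "subspace H" "subspace K" "H \<subseteq> span (B \<union> K)" "fin_dim (H \<inter> K)"
  shows "fin_dim H"
proof -
  obtain C where C: "finite C" "H \<subseteq> span (C \<union> (H \<inter> K))"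
    using finite_extension_over_Int assms by metis
  obtain D where D: "finite D" "H \<inter> K \<subseteq> span D"
    using assms by (auto simp: fin_dim_def)
  have "C \<union> (H \<inter> K) \<subseteq> span (C \<union> D)"
    using D span_superset[of "C \<union> D"] span_mono[of D "C \<union> D"] by blast
  then have "H \<subseteq> span (C \<union> D)"
    using C by (metis order_trans span_minimal subspace_span)
  then show ?thesis using C D by (auto simp: fin_dim_def)
qed

lemma fin_dim_if_kernel_range:
  fixes T :: "'a::real_vector \<Rightarrow> 'b::real_vector"
  assumes "linear T" "subspace G" "fin_dim (T ` G)" "fin_dim {x\<in>G. T x = 0}"
  shows "fin_dim G"
proof -
  obtain D where D: "finite D" "T ` G \<subseteq> span D"
    using assms by (auto simp: fin_dim_def)
  \<comment> \<open>The basis is taken inside the image, not from \<open>D\<close>, so that its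
    elements have preimages in \<open>G\<close>.\<close>
  obtain B where B: "B \<subseteq> T ` G" "independent B" "T ` G \<subseteq> span B"
    by (meson maximal_independent_subset)
  then have "finite B"
    using independent_span_bound[OF D(1) B(2)] D(2) by blast
  then obtain C where C: "finite C" "C \<subseteq> G" "T ` C = B"
    by (metis B(1) finite_subset_image)
  define K where "K = {x\<in>G. T x = 0}"
  have K: "subspace K"
    unfolding K_def using assms(1,2)
    by (auto simp: subspace_def linear_0 linear_add linear_scale)
  have "G \<subseteq> span (C \<union> K)"
  proof
    fix x assume x: "x \<in> G"
    have "T x \<in> T ` span C"
      using B(3) x linear_span_image[OF assms(1), of C] C(3) by auto
    then obtain c where c: "c \<in> span C" "T c = T x" by force
    have "c \<in> G" using c(1) C(2) assms(2) by (meson span_minimal subsetD)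
    then have "x - c \<in> K"
      using x c assms by (auto simp: K_def subspace_diff linear_diff)
    then have "x - c \<in> span (C \<union> K)" by (intro span_base) simp
    moreover have "c \<in> span (C \<union> K)"
      using c(1) span_mono[of C "C \<union> K"] by auto
    ultimately have "c + (x - c) \<in> span (C \<union> K)"
      by (rule span_add[rotated])
    then show "x \<in> span (C \<union> K)" by simp
  qed
  moreover have "fin_dim (G \<inter> K)"
    using assms(4) by (rule fin_dim_subset) (auto simp: K_def)
  ultimately show ?thesis
    using fin_dim_if_fin_dim_Int C(1) K assms(2) by blast
qed

lemma span_image_lessThan_eq_sum:
  fixes f :: "nat \<Rightarrow> 'a::real_vector"
  assumes "x \<in> span (f ` {..<n})"
  obtains a where "x = (\<Sum>k<n. a k *\<^sub>R f k)"
proof -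
  have "\<exists>a. x = (\<Sum>k<n. a k *\<^sub>R f k)"
    using assms
  proof (induction n arbitrary: x)
    case (Suc n)
    then obtain c where "x - c *\<^sub>R f n \<in> span (f ` {..<n})"
      by (auto simp: lessThan_Suc span_breakdown_eq)
    with Suc.IH obtain a where "x - c *\<^sub>R f n = (\<Sum>k<n. a k *\<^sub>R f k)" by blast
    then have "x = (\<Sum>k<Suc n. (a(n := c)) k *\<^sub>R f k)"
      by (simp add: algebra_simps)
    then show ?case by (intro exI[of _ "a(n := c)"])
  qed simp
  then show thesis using that by blast
qed

lemma not_fin_dim_span_range:
  fixes f :: "nat \<Rightarrow> 'a::real_vector"
  assumes indep: "\<And>N a k. (\<Sum>j<N. a j *\<^sub>R f j) = 0 \<Longrightarrow> k < N \<Longrightarrow> a k = 0"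
  shows "\<not> fin_dim (span (range f))"
proof
  have notin: "f n \<notin> span (f ` {..<n})" for n
  proof
    assume "f n \<in> span (f ` {..<n})"
    then obtain a where a: "f n = (\<Sum>k<n. a k *\<^sub>R f k)"
      by (rule span_image_lessThan_eq_sum)
    then have "(\<Sum>k<Suc n. (a(n := -1)) k *\<^sub>R f k) = 0" by simp
    from indep[OF this, of n] show False by simp
  qed
  assume "fin_dim (span (range f))"
  then obtain B where B: "finite B" "span (range f) \<subseteq> span B"
    by (auto simp: fin_dim_def)
  have *: "independent (f ` {..<n}) \<and> card (f ` {..<n}) = n" for n
  proof (induction n)
    case (Suc n)
    have "f n \<notin> f ` {..<n}" using notin[of n] by (auto intro: span_base)
    then show ?case
      using Suc notin[of n] by (simp add: lessThan_Suc independent_insertI)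
  qed (auto simp: independent_empty)
  have "f ` {..<Suc (card B)} \<subseteq> span B"
    using B(2) by (auto intro: span_base)
  then have "card (f ` {..<Suc (card B)}) \<le> card B"
    using independent_span_bound[OF B(1), of "f ` {..<Suc (card B)}"] *[of "Suc (card B)"] by simp
  then show False using *[of "Suc (card B)"] by simp
qed

lemma riesz_separated_sequence:
  fixes Y :: "'a::real_normed_vector set"
  assumes "subspace Y" "\<not> fin_dim Y"
  obtains y where "\<And>n::nat. y n \<in> Y" "\<And>n. norm (y n) = 1"
    "\<And>m n. m < n \<Longrightarrow> 1/2 \<le> dist (y n) (y m)"
proof -
  \<comment> \<open>\<open>sequence_choice\<close> asks for a choice over every finite
    \<open>A\<close>, so membership in \<open>Y\<close> becomes a premise of the property; it is
    discharged afterwards by strong induction.\<close>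
  have "\<exists>y. A \<subseteq> Y \<longrightarrow> y \<in> Y \<and> norm y = 1 \<and> (\<forall>x\<in>A. 1/2 \<le> dist y x)" if "finite A" for A
  proof (cases "A \<subseteq> Y")
    case True
    have "\<not> Y \<subseteq> span A" using assms(2) that unfolding fin_dim_def by metis
    then obtain v where v: "v \<in> Y" "v \<notin> span A" by auto
    have cl: "closed (span A)"
      using closed_span_Un_finite[OF that, of "{}"] by simp
    define d where "d = infdist v (span A)"
    have ne: "span A \<noteq> {}" using span_zero by blast
    have "d > 0"
      unfolding d_def using cl ne v(2) by (simp add: infdist_pos_not_in_closed)
    \<comment> \<open>Riesz's lemma: the distance need not be attained, but some \<open>w\<close>
      comes within twice of it, and normalising \<open>v - w\<close> turns this factor 2 into the
      separation 1/2.\<close>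
    have "infdist v (span A) < 2 * d" using \<open>d > 0\<close> by (simp add: d_def)
    then obtain w where w: "w \<in> span A" "dist v w < 2 * d"
      using infdist_notempty[OF ne, of v] cINF_less_iff[of "span A" "dist v" "2*d"] ne
      by (metis bdd_belowI2 zero_le_dist)
    define y where "y = (v - w) /\<^sub>R norm (v - w)"
    have vw: "v \<noteq> w" using v w by auto
    have "w \<in> Y" using w(1) True assms(1) by (meson span_minimal subsetD)
    then have "y \<in> Y" unfolding y_def using v assms by (intro subspace_scale subspace_diff)
    moreover have "norm y = 1" using vw by (simp add: y_def)
    moreover have "1/2 \<le> dist y x" if "x \<in> A" for x
    proof -
      let ?z = "w + norm (v - w) *\<^sub>R x"
      have "?z \<in> span A" using w that by (simp add: span_add span_scale span_base)
      then have "d \<le> norm (v - ?z)"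
        unfolding d_def by (metis infdist_le dist_norm)
      also have "v - ?z = norm (v - w) *\<^sub>R (y - x)"
        using vw by (simp add: y_def algebra_simps)
      also have "norm \<dots> = norm (v - w) * dist y x" by (simp add: dist_norm)
      also have "\<dots> \<le> 2 * d * dist y x"
        using w(2) by (intro mult_right_mono) (auto simp: dist_norm)
      finally show ?thesis using \<open>d > 0\<close> by simp
    qed
    ultimately show ?thesis by blast
  qed auto
  note * = this
  obtain y :: "nat \<Rightarrow> 'a" where y: "\<And>n. y ` {..<n} \<subseteq> Y \<longrightarrow>
      y n \<in> Y \<and> norm (y n) = 1 \<and> (\<forall>x\<in>y ` {..<n}. 1/2 \<le> dist (y n) x)"
    by (rule sequence_choice[where P = "\<lambda>n A y. A \<subseteq> Y \<longrightarrow> y \<in> Y \<and> norm y = 1 \<and> (\<forall>x\<in>A. 1/2 \<le> dist y x)"])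
      (erule *, rule that)
  have "y n \<in> Y" for n
  proof (induction n rule: less_induct)
    case (less n)
    then have "y ` {..<n} \<subseteq> Y" by auto
    then show ?case using y by blast
  qed
  then have "y ` {..<n} \<subseteq> Y" for n by blast
  then show thesis
    using y by (intro that[of y]) auto
qed

text \<open>A Riesz sequence of unit vectors in an infinite-dimensional \<open>H\<close> has images
  at mutual distance at least \<open>c / 2\<close>, which excludes the convergent subsequence that
  compactness provides.\<close>

lemma fin_dim_if_compact_bounded_below:
  fixes T :: "'a::real_normed_vector \<Rightarrow> 'b::real_normed_vector"
  assumes "linear T" "subspace H" "H \<subseteq> G" "bounded_below_on H T" "compact_on G T"
  shows "fin_dim H"
proof (rule ccontr)
  assume "\<not> fin_dim H"
  then obtain y where y: "\<And>n::nat. y n \<in> H" "\<And>n. norm (y n) = 1"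
    "\<And>m n. m < n \<Longrightarrow> 1/2 \<le> dist (y n) (y m)"
    using riesz_separated_sequence assms(2) by blast
  obtain c where c: "c > 0" "\<And>x. x \<in> H \<Longrightarrow> c * norm x \<le> norm (T x)"
    using assms(4) by (auto simp: bounded_below_on_def)
  have sep: "c / 2 \<le> dist (T (y n)) (T (y m))" if "m < n" for m n
  proof -
    have "c * (1/2) \<le> c * norm (y n - y m)"
      using c(1) y(3)[OF that] by (intro mult_left_mono) (auto simp: dist_norm)
    also have "\<dots> \<le> norm (T (y n - y m))"
      using y assms(2) by (intro c subspace_diff)
    finally show ?thesis using assms(1) by (simp add: dist_norm linear_diff)
  qed
  have "T (y n) \<in> closure (T ` (G \<inter> cball 0 1))" for n
    using y(1,2) assms(3) by (intro subsetD[OF closure_subset] imageI) auto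
  moreover have "seq_compact (closure (T ` (G \<inter> cball 0 1)))"
    using assms(5) compact_imp_seq_compact by (auto simp: compact_on_def)
  ultimately obtain l r where "strict_mono (r::nat \<Rightarrow> nat)" "((\<lambda>n. T (y n)) \<circ> r) \<longlonglongrightarrow> l"
    unfolding seq_compact_def by metis
  moreover from this have "Cauchy ((\<lambda>n. T (y n)) \<circ> r)"
    using LIMSEQ_imp_Cauchy by blast
  ultimately obtain M where M: "\<forall>m\<ge>M. \<forall>n\<ge>M. dist (T (y (r m))) (T (y (r n))) < c/2"
    and r: "strict_mono r"
    using c(1) unfolding Cauchy_def comp_def by (meson half_gt_zero)
  then have "dist (T (y (r (Suc M)))) (T (y (r M))) < c / 2" by simp
  moreover have "r M < r (Suc M)" using r by (simp add: strict_mono_def)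
  ultimately show False using sep by force
qed

section \<open>Disjointness in Banach lattices\<close>

instance banach_lattice \<subseteq> lattice_ab_group_add ..

lemma lmod_leI: "x \<le> a \<Longrightarrow> - x \<le> a \<Longrightarrow> lmod x \<le> a"
  by (simp add: lmod_def)

lemma le_lmod: "x \<le> lmod x" "- x \<le> lmod x"
  by (simp_all add: lmod_def)

lemma lmod_nonneg: "0 \<le> lmod x"
proof -
  have "x + - x \<le> lmod x + lmod x"
    by (intro add_mono le_lmod)
  then show ?thesis by simp
qed

lemma lmod_0 [simp]: "lmod 0 = 0"
  by (simp add: lmod_def)

lemma lmod_minus [simp]: "lmod (- x) = lmod x"
  by (simp add: lmod_def sup_commute)

lemma lmod_add_le: "lmod (x + y) \<le> lmod x + lmod y"
  using add_mono[OF le_lmod(1)[of x] le_lmod(1)[of y]] add_mono[OF le_lmod(2)[of x] le_lmod(2)[of y]]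
  by (intro lmod_leI) simp_all

lemma lmod_scaleR_le: "lmod (c *\<^sub>R x) \<le> \<bar>c\<bar> *\<^sub>R lmod x"
proof -
  have *: "c *\<^sub>R x \<le> \<bar>c\<bar> *\<^sub>R lmod x" for c :: real and x :: 'a
  proof (cases "c \<ge> 0")
    case True
    then show ?thesis by (simp add: scaleR_left_mono le_lmod)
  next
    case False
    then have "\<bar>c\<bar> *\<^sub>R (- x) \<le> \<bar>c\<bar> *\<^sub>R lmod x"
      by (intro scaleR_left_mono le_lmod) simp
    then show ?thesis using False by simp
  qed
  show ?thesis
    using *[of c x] *[of "- c" x] by (intro lmod_leI) simp_all
qed

lemma norm_le_if_lmod_le: "lmod x \<le> lmod y \<Longrightarrow> norm x \<le> norm y"
  unfolding lmod_def by (rule lattice_norm_mono)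

text \<open>Addition distributes over \<open>inf\<close>, so the right side is the infimum of
  \<open>a + a\<close>, \<open>b + a\<close>, \<open>a + c\<close> and \<open>b + c\<close>;
  positivity puts the left side below each of them.\<close>

lemma inf_add_le:
  fixes a b c :: "'a::lattice_ab_group_add"
  assumes "0 \<le> a" "0 \<le> b" "0 \<le> c"
  shows "inf a (b + c) \<le> inf a b + inf a c"
proof -
  let ?z = "inf a (b + c)"
  have za: "?z \<le> a" and zbc: "?z \<le> b + c" by simp_all
  have "?z \<le> a + a" "?z \<le> b + a" "?z \<le> a + c"
    using add_mono[OF za assms(1)] add_mono[OF assms(2) za] add_mono[OF za assms(3)] by simp_all
  then show ?thesis
    using zbc by (simp add: add_inf_distrib_left add_inf_distrib_right)
qed

lemma ldisjoint_commute: "ldisjoint x y \<longleftrightarrow> ldisjoint y x"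
  by (simp add: ldisjoint_def inf_commute)

lemma ldisjoint_0_right: "ldisjoint x 0"
  by (simp add: ldisjoint_def inf_absorb2 lmod_nonneg)

lemma ldisjointI: "inf (lmod x) (lmod y) \<le> 0 \<Longrightarrow> ldisjoint x y"
  unfolding ldisjoint_def by (intro antisym) (simp_all add: lmod_nonneg)

lemma ldisjoint_add_right:
  assumes "ldisjoint x y" "ldisjoint x z"
  shows "ldisjoint x (y + z)"
proof (rule ldisjointI)
  have "inf (lmod x) (lmod (y + z)) \<le> inf (lmod x) (lmod y + lmod z)"
    by (intro inf_mono lmod_add_le order_refl)
  also have "\<dots> \<le> inf (lmod x) (lmod y) + inf (lmod x) (lmod z)"
    by (intro inf_add_le lmod_nonneg)
  finally show "inf (lmod x) (lmod (y + z)) \<le> 0"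
    using assms by (simp add: ldisjoint_def)
qed

lemma ldisjoint_scaleR_right:
  assumes "ldisjoint x y"
  shows "ldisjoint x (c *\<^sub>R y)"
proof (rule ldisjointI)
  \<comment> \<open>A single factor that dominates both 1 and \<open>\<bar>c\<bar>\<close>: dividing
    by it puts \<open>z\<close> below both moduli at once.\<close>
  define s where "s = max 1 \<bar>c\<bar>"
  define z where "z = inf (lmod x) (lmod (c *\<^sub>R y))"
  have "s > 0" by (simp add: s_def)
  have "z \<le> 1 *\<^sub>R lmod x" by (simp add: z_def)
  also have "\<dots> \<le> s *\<^sub>R lmod x"
    by (intro scaleR_right_mono lmod_nonneg) (simp add: s_def)
  finally have zx: "z \<le> s *\<^sub>R lmod x" .
  have "z \<le> lmod (c *\<^sub>R y)" by (simp add: z_def)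
  also have "\<dots> \<le> \<bar>c\<bar> *\<^sub>R lmod y" by (rule lmod_scaleR_le)
  also have "\<dots> \<le> s *\<^sub>R lmod y"
    by (intro scaleR_right_mono lmod_nonneg) (simp add: s_def)
  finally have zy: "z \<le> s *\<^sub>R lmod y" .
  have "z /\<^sub>R s \<le> inf (lmod x) (lmod y)"
    using zx zy \<open>s > 0\<close> by (simp add: pos_divideR_le_eq)
  also have "\<dots> = 0" using assms by (simp add: ldisjoint_def)
  finally have "s *\<^sub>R (z /\<^sub>R s) \<le> s *\<^sub>R 0"
    using \<open>s > 0\<close> by (intro scaleR_left_mono) simp_all
  then show "inf (lmod x) (lmod (c *\<^sub>R y)) \<le> 0"
    using \<open>s > 0\<close> by (simp add: z_def)
qed

lemma ldisjoint_span_right: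
  assumes "y \<in> span A" "\<And>a. a \<in> A \<Longrightarrow> ldisjoint x a"
  shows "ldisjoint x y"
  using assms(1)
  by (induction rule: span_induct_alt)
     (simp_all add: ldisjoint_0_right ldisjoint_add_right ldisjoint_scaleR_right assms(2))

text \<open>The modulus of \<open>x\<close> is at most \<open>lmod (x + y) + lmod y\<close>; since
  it is disjoint from the second summand, it already lies below the first.\<close>

lemma norm_le_norm_add_if_ldisjoint:
  assumes "ldisjoint x y"
  shows "norm x \<le> norm (x + y)"
proof (rule norm_le_if_lmod_le)
  have "lmod x \<le> lmod (x + y) + lmod y"
    using lmod_add_le[of "x + y" "- y"] by simp
  then have "lmod x \<le> inf (lmod x) (lmod (x + y) + lmod y)" by simp
  also have "\<dots> \<le> inf (lmod x) (lmod (x + y)) + inf (lmod x) (lmod y)"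
    by (intro inf_add_le lmod_nonneg)
  also have "\<dots> \<le> lmod (x + y)"
    using assms by (simp add: ldisjoint_def)
  finally show "lmod x \<le> lmod (x + y)" .
qed

lemma disjoint_seq_spans:
  assumes "disjoint_seq f" "A \<inter> B = {}" "x \<in> span (f ` A)" "y \<in> span (f ` B)"
  shows "ldisjoint x y"
proof (rule ldisjoint_span_right[OF assms(4)])
  fix b assume "b \<in> f ` B"
  then obtain j where j: "j \<in> B" "b = f j" by auto
  have "ldisjoint b x"
  proof (rule ldisjoint_span_right[OF assms(3)])
    fix a assume "a \<in> f ` A"
    then obtain i where "i \<in> A" "a = f i" by auto
    moreover from this have "j \<noteq> i" using j assms(2) by auto
    ultimately show "ldisjoint b a" using j assms(1) by (simp add: disjoint_seq_def)
  qed
  then show "ldisjoint x b" by (simp add: ldisjoint_commute)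
qed

text \<open>The remaining terms are disjoint from the \<open>k\<close>-th one, so coordinate
  projections are contractions. Every coefficient bound for disjoint sequences comes from
  here.\<close>

lemma disjoint_seq_norm_coeff_le:
  assumes "disjoint_seq f" "finite K" "k \<in> K"
  shows "norm (a k *\<^sub>R f k) \<le> norm (\<Sum>j\<in>K. a j *\<^sub>R f j)"
proof -
  have "ldisjoint (a k *\<^sub>R f k) (\<Sum>j\<in>K - {k}. a j *\<^sub>R f j)"
    by (rule disjoint_seq_spans[OF assms(1), of "{k}" "K - {k}"])
       (auto intro!: span_sum span_scale intro: span_base)
  then show ?thesis
    unfolding sum.remove[OF assms(2,3)] by (rule norm_le_norm_add_if_ldisjoint)
qed

lemma disjoint_seq_not_fin_dim:
  assumes "disjoint_seq f" "\<And>n. f n \<noteq> 0"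
  shows "\<not> fin_dim (span (range f))"
proof (rule not_fin_dim_span_range)
  fix N k and a :: "nat \<Rightarrow> real"
  assume "(\<Sum>j<N. a j *\<^sub>R f j) = 0" "k < N"
  then have "norm (a k *\<^sub>R f k) \<le> 0"
    using disjoint_seq_norm_coeff_le[OF assms(1), of "{..<N}" k a] by simp
  then show "a k = 0"
    unfolding norm_le_zero_iff scaleR_eq_0_iff using assms(2) by simp
qed

lemma disjoint_seq_subseq:
  "disjoint_seq f \<Longrightarrow> inj r \<Longrightarrow> disjoint_seq (\<lambda>n. f (r n))"
  by (auto simp: disjoint_seq_def inj_def)

lemma disjoint_seq_scaleR:
  assumes "disjoint_seq f"
  shows "disjoint_seq (\<lambda>n. c n *\<^sub>R f n)"
  unfolding disjoint_seq_def
proof (intro allI impI)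
  fix m n :: nat assume "m \<noteq> n"
  then have "ldisjoint (f m) (c n *\<^sub>R f n)"
    using assms by (intro ldisjoint_scaleR_right) (simp add: disjoint_seq_def)
  then show "ldisjoint (c m *\<^sub>R f m) (c n *\<^sub>R f n)"
    using ldisjoint_scaleR_right ldisjoint_commute by blast
qed

section \<open>Finite sums in spans and the gliding hump\<close>

lemma span_range_eq_sum:
  fixes f :: "nat \<Rightarrow> 'a::real_vector"
  assumes "x \<in> span (range f)"
  obtains N a where "x = (\<Sum>k<N. a k *\<^sub>R f k)"
proof -
  have "\<exists>N a. x = (\<Sum>k<N. a k *\<^sub>R f k)"
    using assms
  proof (induction rule: span_induct_alt)
    case base
    show ?case by (intro exI[of _ 0]) simp
  next
    case (step c x y)
    then obtain j N a where x: "x = f j" and y: "y = (\<Sum>k<N. a k *\<^sub>R f k)" by auto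
    define M where "M = max N (Suc j)"
    have "(\<Sum>k<M. (if k = j then c else 0) *\<^sub>R f k) = (\<Sum>k<M. if k = j then c *\<^sub>R f k else 0)"
      by (intro sum.cong) auto
    also have "\<dots> = c *\<^sub>R x" by (simp add: M_def less_max_iff_disj x)
    finally have 1: "(\<Sum>k<M. (if k = j then c else 0) *\<^sub>R f k) = c *\<^sub>R x" .
    have 2: "(\<Sum>k<M. (if k < N then a k else 0) *\<^sub>R f k) = y"
      unfolding y by (intro sum.mono_neutral_cong_right) (auto simp: M_def)
    have "c *\<^sub>R x + y = (\<Sum>k<M. ((if k = j then c else 0) + (if k < N then a k else 0)) *\<^sub>R f k)"
      using 1 2 by (simp only: scaleR_left_distrib sum.distrib)
    then show ?case
      by (intro exI[of _ M] exI[of _ "\<lambda>k. (if k = j then c else 0) + (if k < N then a k else 0)"])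
  qed
  then show thesis using that by blast
qed

text \<open>Each chosen vector is replaced by a nearby finite combination, and the next vector is
  taken from the tail beyond its support; the combinations then occupy disjoint blocks.
  \<open>Q\<close> is abstract because two properties are fed in: being a unit vector of a given
  subspace, and being a unit vector with small image.\<close>

lemma gliding_hump:
  fixes f :: "nat \<Rightarrow> 'f::banach_lattice"
  assumes "disjoint_seq f"
    and "\<And>m k. \<exists>e. Q k e \<and> e \<in> closure (span (f ` {m..}))"
  obtains e g where "\<And>k::nat. Q k (e k)" "disjoint_seq g" "(\<lambda>n. norm (g n - e n)) \<longlonglongrightarrow> 0"
proof -
  \<comment> \<open>In a triple \<open>(e, g, M)\<close>, \<open>g\<close> approximates \<open>e\<close> and has coordinates only below \<open>M\<close>.\<close>
  define P :: "nat \<Rightarrow> ('f \<times> 'f \<times> nat) set \<Rightarrow> 'f \<times> 'f \<times> nat \<Rightarrow> bool" where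
    "P n A = (\<lambda>(e, g, M). Q n e \<and> norm (g - e) < 1 / Suc n \<and> g \<in> span (f ` {..<M}) \<and>
       (\<forall>(e', g', M')\<in>A. g \<in> span (f ` {M'..})))" for n A
  have "\<exists>p. P n A p" if "finite A" for n A
  proof -
    \<comment> \<open>The first index beyond all earlier supports; the inserted 0 covers the empty
      history.\<close>
    define m where "m = Max (insert 0 ((\<lambda>(e, g, M). M) ` A))"
    have m: "M' \<le> m" if "(e', g', M') \<in> A" for e' g' M'
      unfolding m_def using that \<open>finite A\<close> by (intro Max_ge) force+
    obtain e where e: "Q n e" "e \<in> closure (span (f ` {m..}))"
      using assms(2) by blast
    moreover have "0 < 1 / real (Suc n)" by simp
    ultimately obtain g where g: "g \<in> span (f ` {m..})" "dist g e < 1 / Suc n"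
      unfolding closure_approachable by blast
    \<comment> \<open>Membership in the tail span bounds the support from below only; expanding
      \<open>g\<close> as a finite sum yields the upper end \<open>N\<close> of its block.\<close>
    have "g \<in> span (range f)" using g(1) span_mono[of "f ` {m..}" "range f"] by auto
    then obtain N a where "g = (\<Sum>k<N. a k *\<^sub>R f k)" using span_range_eq_sum by blast
    then have "g \<in> span (f ` {..<N})" by (auto intro!: span_sum span_scale intro: span_base)
    moreover have "g \<in> span (f ` {M'..})" if "(e', g', M') \<in> A" for e' g' M'
      using g(1) m[OF that] span_mono[OF image_mono, of "{m..}" "{M'..}" f] by auto
    ultimately have "P n A (e, g, N)" using e g by (auto simp: P_def dist_norm)
    then show ?thesis by blast
  qed
  note ex = this
  obtain h where h: "\<And>n. P n (h ` {..<n}) (h n)"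
    by (rule sequence_choice[of P]) (rule ex, assumption, rule that)
  define e where "e n = fst (h n)" for n
  define g where "g n = fst (snd (h n))" for n
  define M where "M n = snd (snd (h n))" for n
  have hn: "h n = (e n, g n, M n)" for n
    by (simp add: e_def g_def M_def)
  have Q: "Q n (e n)" and close: "norm (g n - e n) < 1 / Suc n"
    and gM: "g n \<in> span (f ` {..<M n})" for n
    using h[of n] unfolding hn[of n] P_def by auto
  have gt: "g n \<in> span (f ` {M k..})" if "k < n" for k n
  proof -
    have "(e k, g k, M k) \<in> h ` {..<n}" using that hn[of k] by force
    then show ?thesis using h[of n] unfolding hn[of n] P_def by blast
  qed
  have dis: "ldisjoint (g k) (g n)" if "k < n" for k n
    by (rule disjoint_seq_spans[OF assms(1) _ gM gt[OF that]]) auto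
  have "disjoint_seq g"
    unfolding disjoint_seq_def
  proof (intro allI impI)
    fix m n :: nat assume "m \<noteq> n"
    then show "ldisjoint (g m) (g n)"
      using dis[of m n] dis[of n m] ldisjoint_commute[of "g m"] by (cases "m < n") auto
  qed
  moreover have "(\<lambda>n. norm (g n - e n)) \<longlonglongrightarrow> 0"
  proof (rule tendsto_sandwich[OF _ _ tendsto_const LIMSEQ_inverse_real_of_nat])
    show "\<forall>\<^sub>F n in sequentially. norm (g n - e n) \<le> inverse (real (Suc n))"
      using close by (auto simp: inverse_eq_divide less_imp_le)
  qed auto
  ultimately show thesis using that Q by blast
qed

section \<open>Functionals and compact operators\<close>

text \<open>Functionals are represented by their graphs: a subspace of the product on which the second
  component is dominated by the norm of the first is automatically single-valued, so Zorn's lemma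
  applies to plain sets.\<close>

lemma hahn_banach_graph:
  fixes H0 :: "('a::real_normed_vector \<times> real) set"
  assumes "subspace H0" "\<And>p. p \<in> H0 \<Longrightarrow> snd p \<le> norm (fst p)"
  obtains \<phi> :: "'a \<Rightarrow>\<^sub>L real" where "\<And>x. \<bar>blinfun_apply \<phi> x\<bar> \<le> norm x"
    "\<And>x a. (x, a) \<in> H0 \<Longrightarrow> blinfun_apply \<phi> x = a"
proof -
  define \<A> where "\<A> = {H :: ('a \<times> real) set. subspace H \<and> H0 \<subseteq> H \<and> (\<forall>p\<in>H. snd p \<le> norm (fst p))}"
  have "\<exists>M\<in>\<A>. \<forall>X\<in>\<A>. M \<subseteq> X \<longrightarrow> X = M"
  proof (rule subset_Zorn_nonempty)
    show "\<A> \<noteq> {}" using assms by (auto simp: \<A>_def)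
  next
    fix \<C> assume ne: "\<C> \<noteq> {}" and ch: "subset.chain \<A> \<C>"
    have sub: "X \<in> \<A>" if "X \<in> \<C>" for X
      using ch that by (auto simp: subset.chain_def)
    have tot: "X \<subseteq> Y \<or> Y \<subseteq> X" if "X \<in> \<C>" "Y \<in> \<C>" for X Y
      using ch that by (auto simp: subset_chain_def)
    have "subspace (\<Union>\<C>)"
      unfolding subspace_def
    proof (intro conjI ballI allI)
      obtain X where "X \<in> \<C>" using ne by auto
      then show "0 \<in> \<Union>\<C>" using sub[of X] subspace_0 by (auto simp: \<A>_def)
    next
      fix x y assume "x \<in> \<Union>\<C>" "y \<in> \<Union>\<C>"
      then obtain X Y where XY: "X \<in> \<C>" "Y \<in> \<C>" "x \<in> X" "y \<in> Y" by auto
      obtain Z where Z: "Z \<in> \<C>" "x \<in> Z" "y \<in> Z"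
        using tot[OF XY(1,2)] XY by blast
      then have "x + y \<in> Z" using sub[OF Z(1)] by (simp add: \<A>_def subspace_add)
      then show "x + y \<in> \<Union>\<C>" using Z(1) by blast
    next
      fix c x assume "x \<in> \<Union>\<C>"
      then obtain X where X: "X \<in> \<C>" "x \<in> X" by auto
      then have "c *\<^sub>R x \<in> X" using sub[OF X(1)] by (simp add: \<A>_def subspace_scale)
      then show "c *\<^sub>R x \<in> \<Union>\<C>" using X(1) by blast
    qed
    moreover have "H0 \<subseteq> \<Union>\<C>" using ne sub by (fastforce simp: \<A>_def)
    moreover have "\<forall>p\<in>\<Union>\<C>. snd p \<le> norm (fst p)" using sub by (fastforce simp: \<A>_def)
    ultimately show "\<Union>\<C> \<in> \<A>" by (simp add: \<A>_def)
  qed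
  then obtain M where "M \<in> \<A>" and max: "\<And>X. X \<in> \<A> \<Longrightarrow> M \<subseteq> X \<Longrightarrow> X = M" by blast
  then have M: "subspace M" "H0 \<subseteq> M" and bd: "\<And>x a. (x, a) \<in> M \<Longrightarrow> a \<le> norm x"
    by (auto simp: \<A>_def)
  have spanM: "span M = M" using M(1) by simp
  \<comment> \<open>Closure under negation makes the one-sided domination two-sided; at first
    component 0 this gives single-valuedness.\<close>
  have bd': "\<bar>a\<bar> \<le> norm x" if "(x, a) \<in> M" for x a
    using bd[OF that] bd[of "- x" "- a"] subspace_neg[OF M(1) that] by simp
  have unique: "a = b" if "(x, a) \<in> M" "(x, b) \<in> M" for x a b
    using subspace_diff[OF M(1) that] bd'[of 0 "a - b"] by simp
  have total: "\<exists>c. (z, c) \<in> M" for z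
  proof -
    \<comment> \<open>A value at \<open>z\<close> is admissible if it lies between all the lower
      bounds \<open>snd p - norm (fst p - z)\<close> and all the upper bounds
      \<open>norm (fst q + z) - snd q\<close>. The triangle inequality in \<open>le\<close> puts
      every lower bound below every upper one, so the supremum of the former works.\<close>
    define c where "c = (SUP p\<in>M. snd p - norm (fst p - z))"
    have le: "snd p - norm (fst p - z) \<le> norm (fst q + z) - snd q" if "p \<in> M" "q \<in> M" for p q
    proof -
      have "snd p + snd q \<le> norm (fst p + fst q)"
        using bd[of "fst p + fst q" "snd p + snd q"] subspace_add[OF M(1) that] by (simp add: plus_prod_def)
      also have "fst p + fst q = (fst p - z) + (fst q + z)" by simp
      also have "norm \<dots> \<le> norm (fst p - z) + norm (fst q + z)" by (rule norm_triangle_ineq)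
      finally show ?thesis by simp
    qed
    have "0 \<in> M" using M(1) subspace_0 by blast
    have lower: "snd p - norm (fst p - z) \<le> c" if "p \<in> M" for p
      unfolding c_def using that le[OF _ \<open>0 \<in> M\<close>] by (intro cSUP_upper bdd_aboveI2) auto
    have upper: "c \<le> norm (fst q + z) - snd q" if "q \<in> M" for q
      unfolding c_def using that \<open>0 \<in> M\<close> le by (intro cSUP_least) auto
    let ?M = "span (insert (z, c) M)"
    have "snd p \<le> norm (fst p)" if p: "p \<in> ?M" for p
    proof -
      obtain k where k: "p - k *\<^sub>R (z, c) \<in> M"
        using p spanM by (auto simp: span_breakdown_eq)
      define q where "q = p - k *\<^sub>R (z, c)"
      have q: "q \<in> M" "fst p = fst q + k *\<^sub>R z" "snd p = snd q + k * c"
        using k by (simp_all add: q_def)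
      \<comment> \<open>Rescaling by \<open>\<bar>k\<bar>\<close> reduces to coefficient 1 or -1 of
        \<open>z\<close>, where \<open>upper\<close> and \<open>lower\<close> respectively
        apply.\<close>
      consider "k = 0" | "k > 0" | "k < 0" by linarith
      then show ?thesis
      proof cases
        case 1
        then show ?thesis using q bd[of "fst q" "snd q"] by simp
      next
        case 2
        have "c \<le> norm (fst (q /\<^sub>R k) + z) - snd (q /\<^sub>R k)"
          by (intro upper subspace_scale M q)
        then have "k * c \<le> k * norm (fst (q /\<^sub>R k) + z) - k * snd (q /\<^sub>R k)"
          using 2 by (metis mult_le_cancel_left_pos right_diff_distrib)
        moreover have "k * norm (fst (q /\<^sub>R k) + z) = norm (fst p)"
        proof -
          have "k * norm (fst (q /\<^sub>R k) + z) = norm (k *\<^sub>R (fst (q /\<^sub>R k) + z))"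
            using 2 by simp
          also have "k *\<^sub>R (fst (q /\<^sub>R k) + z) = fst p"
            using 2 q by (simp add: scaleR_right_distrib)
          finally show ?thesis .
        qed
        moreover have "k * snd (q /\<^sub>R k) = snd q" using 2 by simp
        ultimately show ?thesis using q(3) by linarith
      next
        case 3
        define l where "l = - k"
        have "l > 0" and p': "fst p = fst q - l *\<^sub>R z" "snd p = snd q - l * c"
          using 3 q by (simp_all add: l_def)
        have "snd (q /\<^sub>R l) - norm (fst (q /\<^sub>R l) - z) \<le> c"
          by (intro lower subspace_scale M q)
        then have "l * snd (q /\<^sub>R l) - l * norm (fst (q /\<^sub>R l) - z) \<le> l * c"
          using \<open>l > 0\<close> by (metis mult_le_cancel_left_pos right_diff_distrib)
        moreover have "l * norm (fst (q /\<^sub>R l) - z) = norm (fst p)"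
        proof -
          have "l * norm (fst (q /\<^sub>R l) - z) = norm (l *\<^sub>R (fst (q /\<^sub>R l) - z))"
            using \<open>l > 0\<close> by simp
          also have "l *\<^sub>R (fst (q /\<^sub>R l) - z) = fst p"
            using \<open>l > 0\<close> p' by (simp add: scaleR_right_diff_distrib)
          finally show ?thesis .
        qed
        moreover have "l * snd (q /\<^sub>R l) = snd q" using \<open>l > 0\<close> by simp
        ultimately show ?thesis using p'(2) by linarith
      qed
    qed
    moreover have "M \<subseteq> ?M" by (auto intro: span_base)
    ultimately have "?M \<in> \<A>" using M(2) by (auto simp: \<A>_def)
    then have "?M = M" using \<open>M \<subseteq> ?M\<close> by (rule max)
    moreover have "(z, c) \<in> ?M" by (simp add: span_base)
    ultimately show ?thesis by auto
  qed
  then obtain \<phi> where \<phi>: "\<And>x. (x, \<phi> x) \<in> M" by metis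
  have eq: "\<phi> x = a" if "(x, a) \<in> M" for x a
    using unique \<phi> that by blast
  have "bounded_linear \<phi>"
  proof (rule bounded_linear_intro)
    show "\<phi> (x + y) = \<phi> x + \<phi> y" for x y
      using subspace_add[OF M(1) \<phi> \<phi>, of x y] by (intro eq) simp
    show "\<phi> (r *\<^sub>R x) = r *\<^sub>R \<phi> x" for r x
      using subspace_scale[OF M(1) \<phi>, of r x] by (intro eq) simp
    show "norm (\<phi> x) \<le> norm x * 1" for x
      using bd'[OF \<phi>] by simp
  qed
  then have "blinfun_apply (Blinfun \<phi>) = \<phi>" by (rule bounded_linear_Blinfun_apply)
  then show thesis
    using that[of "Blinfun \<phi>"] bd'[OF \<phi>] eq M(2) by auto
qed

lemma norming_functional:
  fixes x :: "'a::real_normed_vector"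
  obtains \<phi> :: "'a \<Rightarrow>\<^sub>L real" where "\<And>z. \<bar>blinfun_apply \<phi> z\<bar> \<le> norm z"
    "blinfun_apply \<phi> x = norm x"
proof -
  have "snd p \<le> norm (fst p)" if "p \<in> span {(x, norm x)}" for p :: "'a \<times> real"
    using that by (auto simp: span_singleton intro!: mult_right_mono)
  then obtain \<phi> :: "'a \<Rightarrow>\<^sub>L real" where "\<And>z. \<bar>blinfun_apply \<phi> z\<bar> \<le> norm z"
    "\<And>z a. (z, a) \<in> span {(x, norm x)} \<Longrightarrow> blinfun_apply \<phi> z = a"
    using hahn_banach_graph[of "span {(x, norm x)}"] by (metis subspace_span)
  then show thesis using that by (meson insertI1 span_base)
qed

section \<open>Compactness criteria\<close>

lemma compact_closure_if_subset:
  fixes A :: "'a::t2_space set"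
  assumes "A \<subseteq> B" "compact B"
  shows "compact (closure A)"
proof -
  have "closure A \<subseteq> B" using assms by (simp add: closure_minimal compact_imp_closed)
  then have "B \<inter> closure A = closure A" by blast
  then show ?thesis using compact_Int_closed[OF assms(2) closed_closure] by metis
qed

text \<open>The finite boxes \<open>S n\<close> are compact, and summability makes one of them
  approximate all of \<open>A\<close> uniformly, so \<open>A\<close> is totally bounded. Only
  approximation by finite sums is required, which suits both images of closed spans and infinite
  series.\<close>

lemma compact_closure_if_series:
  fixes v :: "nat \<Rightarrow> 'e::banach"
  assumes C: "\<And>k. 0 \<le> C k" and summ: "summable (\<lambda>k. C k * norm (v k))"
    and approx: "\<And>y e. y \<in> A \<Longrightarrow> 0 < e \<Longrightarrow>
      \<exists>N b. (\<forall>k<N. \<bar>b k\<bar> \<le> C k) \<and> dist y (\<Sum>k<N. b k *\<^sub>R v k) < e"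
  shows "compact (closure A)"
  unfolding compact_eq_totally_bounded
proof (intro conjI allI impI)
  show "complete (closure A)" by (simp add: complete_eq_closed)
  fix e :: real assume "e > 0"
  \<comment> \<open>Three errors of this size occur: the finite sum, its truncation at
    \<open>N0\<close>, and the finite net. Their total \<open>3 * e / 4\<close> leaves room for
    closed balls, so that the cover passes to the closure.\<close>
  then have "e / 4 > 0" by simp
  with summ obtain N0 where N0: "\<And>m n. m \<ge> N0 \<Longrightarrow> norm (\<Sum>k=m..<n. C k * norm (v k)) < e / 4"
    unfolding summable_Cauchy by meson
  define S where "S n = {(\<Sum>k<n. b k *\<^sub>R v k) | b. \<forall>k<n. \<bar>b k\<bar> \<le> C k}" for n
  have "compact (S n)" for n
  proof (induction n)
    case 0
    have "S 0 = {0}" by (auto simp: S_def)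
    then show ?case by simp
  next
    case (Suc n)
    let ?L = "(\<lambda>t. t *\<^sub>R v n) ` {- C n..C n}"
    have "compact ?L"
      by (intro compact_continuous_image continuous_intros) simp
    moreover have "S (Suc n) = {x + y | x y. x \<in> S n \<and> y \<in> ?L}" (is "_ = ?R")
    proof (intro equalityI subsetI)
      fix x assume "x \<in> S (Suc n)"
      then obtain b where b: "x = (\<Sum>k<n. b k *\<^sub>R v k) + b n *\<^sub>R v n" "\<forall>k<Suc n. \<bar>b k\<bar> \<le> C k"
        by (auto simp: S_def)
      have "(\<Sum>k<n. b k *\<^sub>R v k) \<in> S n" using b(2) by (auto simp: S_def)
      moreover have "b n *\<^sub>R v n \<in> ?L" using b(2)[rule_format, of n] by (auto simp: abs_le_iff)
      ultimately show "x \<in> ?R" using b(1) by blast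
    next
      fix x assume "x \<in> ?R"
      then obtain b t where b: "x = (\<Sum>k<n. b k *\<^sub>R v k) + t *\<^sub>R v n" "\<forall>k<n. \<bar>b k\<bar> \<le> C k" "\<bar>t\<bar> \<le> C n"
        by (auto simp: S_def abs_le_iff)
      have "x = (\<Sum>k<Suc n. (b(n := t)) k *\<^sub>R v k)" using b(1) by simp
      moreover have "\<forall>k<Suc n. \<bar>(b(n := t)) k\<bar> \<le> C k" using b by (simp add: less_Suc_eq)
      ultimately show "x \<in> S (Suc n)" unfolding S_def by blast
    qed
    ultimately show ?case using compact_sums[OF Suc] by simp
  qed
  then have "\<exists>F. finite F \<and> S N0 \<subseteq> (\<Union>x\<in>F. ball x (e / 4))"
    using \<open>e / 4 > 0\<close> unfolding compact_eq_totally_bounded by blast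
  then obtain F where F: "finite F" "S N0 \<subseteq> (\<Union>x\<in>F. ball x (e / 4))" by blast
  have "A \<subseteq> (\<Union>x\<in>F. cball x (3 * e / 4))"
  proof
    fix y assume "y \<in> A"
    then obtain N b where b: "\<And>k. k < N \<Longrightarrow> \<bar>b k\<bar> \<le> C k" "dist y (\<Sum>k<N. b k *\<^sub>R v k) < e / 4"
      using approx \<open>e / 4 > 0\<close> by blast
    \<comment> \<open>Padding by zeros handles \<open>N < N0\<close> and \<open>N \<ge> N0\<close>
      alike; zero coefficients are admissible because \<open>C k\<close> is nonnegative.\<close>
    define b' where "b' k = (if k < N then b k else 0)" for k
    define M where "M = max N N0"
    let ?z = "\<Sum>k<N0. b' k *\<^sub>R v k"
    have b': "\<bar>b' k\<bar> \<le> C k" for k using b(1) C by (simp add: b'_def)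
    have "(\<Sum>k<N. b k *\<^sub>R v k) = (\<Sum>k<M. b' k *\<^sub>R v k)"
      by (intro sum.mono_neutral_cong_left) (auto simp: M_def b'_def)
    also have "\<dots> = ?z + (\<Sum>k=N0..<M. b' k *\<^sub>R v k)"
      using sum.atLeastLessThan_concat[of 0 N0 M "\<lambda>k. b' k *\<^sub>R v k"] by (simp add: M_def atLeast0LessThan)
    finally have "dist (\<Sum>k<N. b k *\<^sub>R v k) ?z = norm (\<Sum>k=N0..<M. b' k *\<^sub>R v k)"
      by (simp add: dist_norm)
    also have "\<dots> \<le> (\<Sum>k=N0..<M. C k * norm (v k))"
      by (intro sum_norm_le) (simp add: mult_right_mono b')
    also have "\<dots> < e / 4" using N0[of N0 M] by simp
    finally have 1: "dist (\<Sum>k<N. b k *\<^sub>R v k) ?z < e / 4" .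
    have "?z \<in> S N0" using b' unfolding S_def by blast
    then obtain x where x: "x \<in> F" "dist x ?z < e / 4" using F(2) by auto
    have "dist x y \<le> dist x ?z + dist (\<Sum>k<N. b k *\<^sub>R v k) ?z + dist y (\<Sum>k<N. b k *\<^sub>R v k)"
      by metric
    then have "dist x y \<le> 3 * e / 4" using 1 b(2) x(2) by simp
    then show "y \<in> (\<Union>x\<in>F. cball x (3 * e / 4))" using x(1) by auto
  qed
  moreover have "closed (\<Union>x\<in>F. cball x (3 * e / 4))" using F(1) by (intro closed_UN) auto
  ultimately have "closure A \<subseteq> (\<Union>x\<in>F. cball x (3 * e / 4))" by (rule closure_minimal)
  also have "\<dots> \<subseteq> (\<Union>x\<in>F. ball x e)" using \<open>e > 0\<close> by (intro UN_mono) (auto simp: subset_iff)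
  finally show "\<exists>k. finite k \<and> closure A \<subseteq> (\<Union>x\<in>k. ball x e)" using F(1) by blast
qed

text \<open>A point of the unit ball is replaced by a nearby element of the algebraic span, where
  \<open>coeff\<close> applies. The replacement may have norm up to 2, hence the bounds
  \<open>2 * C k\<close>.\<close>

lemma compact_on_closure_span_range:
  fixes x :: "nat \<Rightarrow> 'a::real_normed_vector" and T :: "'a \<Rightarrow> 'e::banach"
  assumes T: "bounded_linear T"
    and coeff: "\<And>N a k. k < N \<Longrightarrow> \<bar>a k\<bar> \<le> C k * norm (\<Sum>j<N. a j *\<^sub>R x j)"
    and C: "\<And>k. 0 \<le> C k" and summ: "summable (\<lambda>k. C k * norm (T (x k)))"
  shows "compact_on (closure (span (range x))) T"
  unfolding compact_on_def
proof (rule compact_closure_if_series[where C = "\<lambda>k. 2 * C k" and v = "\<lambda>k. T (x k)"])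
  interpret T: bounded_linear T by fact
  show "summable (\<lambda>k. 2 * C k * norm (T (x k)))"
    using summable_mult[OF summ, of 2] by (simp add: mult.assoc)
  show "0 \<le> 2 * C k" for k using C by simp
  fix y and e :: real
  assume "y \<in> T ` (closure (span (range x)) \<inter> cball 0 1)" "0 < e"
  then obtain u where u: "y = T u" "u \<in> closure (span (range x))" "norm u \<le> 1" by auto
  obtain K where K: "K > 0" "\<And>z. norm (T z) \<le> norm z * K" using T.pos_bounded by auto
  \<comment> \<open>The 1 keeps \<open>norm w\<close> at most 2; \<open>e / K\<close> makes the
    error after applying \<open>T\<close> smaller than \<open>e\<close>.\<close>
  have "min 1 (e / K) > 0" using \<open>e > 0\<close> K by simp
  then obtain w where w: "w \<in> span (range x)" "dist w u < min 1 (e / K)"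
    using u(2) unfolding closure_approachable by blast
  then obtain N a where a: "w = (\<Sum>k<N. a k *\<^sub>R x k)" using span_range_eq_sum by blast
  have "norm w \<le> dist w u + norm u" by (simp add: dist_norm) (metis norm_triangle_sub add.commute)
  then have "norm w \<le> 2" using w(2) u(3) by simp
  have "\<bar>a k\<bar> \<le> 2 * C k" if "k < N" for k
    using coeff[OF that, of a] mult_left_mono[OF \<open>norm w \<le> 2\<close> C, of k] by (simp add: a)
  moreover have "dist y (\<Sum>k<N. a k *\<^sub>R T (x k)) < e"
  proof -
    have "(\<Sum>k<N. a k *\<^sub>R T (x k)) = T w" by (simp add: a T.sum T.scaleR)
    then have "dist y (\<Sum>k<N. a k *\<^sub>R T (x k)) = norm (T (w - u))"
      by (simp add: u(1) dist_norm T.diff norm_minus_commute)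
    also have "\<dots> \<le> dist w u * K" using K(2) by (simp add: dist_norm)
    also have "\<dots> < e" using w(2) K(1) by (simp add: field_simps)
    finally show ?thesis .
  qed
  ultimately show "\<exists>N b. (\<forall>k<N. \<bar>b k\<bar> \<le> 2 * C k) \<and> dist y (\<Sum>k<N. b k *\<^sub>R T (x k)) < e"
    by blast
qed

text \<open>Forward substitution bounds the \<open>k\<close>-th coefficient by the norm of the sum
  plus all earlier coefficients; this identity says that \<open>2 ^ k\<close> solves that recursion
  exactly.\<close>

lemma sum_pow2: "1 + (\<Sum>j<k. 2 ^ j) = (2 ^ k :: real)"
  by (induction k) simp_all

text \<open>Kato's construction: each vector lies in the kernels of norming functionals of its
  predecessors, so coefficients are found by forward substitution, which gives the factors \<open>2 ^ k\<close>.\<close>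

lemma compact_on_subspace_if_small:
  fixes T :: "'a::real_normed_vector \<Rightarrow> 'e::banach"
  assumes T: "bounded_linear T"
    and small: "\<And>\<Phi> e. finite \<Phi> \<Longrightarrow> 0 < e \<Longrightarrow>
      \<exists>x\<in>G. norm x = 1 \<and> norm (T x) < e \<and> (\<forall>\<phi>\<in>\<Phi>. blinfun_apply \<phi> x = (0::real))"
  obtains x :: "nat \<Rightarrow> 'a" where "range x \<subseteq> G" "\<not> fin_dim (span (range x))"
    "compact_on (closure (span (range x))) T"
proof -
  \<comment> \<open>The rate \<open>(1/4) ^ n\<close> beats the coefficient bound
    \<open>2 ^ k\<close>, leaving the summable \<open>(1/2) ^ k\<close>.\<close>
  define P :: "nat \<Rightarrow> ('a \<times> ('a \<Rightarrow>\<^sub>L real)) set \<Rightarrow> 'a \<times> ('a \<Rightarrow>\<^sub>L real) \<Rightarrow> bool" where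
    "P n A = (\<lambda>(x, \<phi>). x \<in> G \<and> norm x = 1 \<and> norm (T x) < (1/4) ^ n \<and>
       (\<forall>z. \<bar>blinfun_apply \<phi> z\<bar> \<le> norm z) \<and> blinfun_apply \<phi> x = 1 \<and>
       (\<forall>\<psi>\<in>snd ` A. blinfun_apply \<psi> x = 0))" for n A
  have ex: "\<exists>p. P n A p" if "finite A" for n A
  proof -
    obtain x where x: "x \<in> G" "norm x = 1" "norm (T x) < (1/4) ^ n" "\<forall>\<psi>\<in>snd ` A. blinfun_apply \<psi> x = 0"
      using small[OF finite_imageI[OF \<open>finite A\<close>], of "(1/4) ^ n" snd] by auto
    obtain \<phi> :: "'a \<Rightarrow>\<^sub>L real" where "\<And>z. \<bar>blinfun_apply \<phi> z\<bar> \<le> norm z" "blinfun_apply \<phi> x = norm x"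
      using norming_functional[of x] by blast
    then have "P n A (x, \<phi>)" using x by (simp add: P_def)
    then show ?thesis by blast
  qed
  obtain h where h: "\<And>n. P n (h ` {..<n}) (h n)"
    by (rule sequence_choice[of P]) (rule ex, assumption, rule that)
  define x where "x n = fst (h n)" for n
  define \<phi> where "\<phi> n = blinfun_apply (snd (h n))" for n
  have x: "x n \<in> G" "norm (x n) = 1" "norm (T (x n)) < (1/4) ^ n" "\<phi> n (x n) = 1"
    and \<phi>: "\<bar>\<phi> n z\<bar> \<le> norm z" for n z
    using h[of n] by (auto simp: P_def x_def \<phi>_def split: prod.splits)
  have zero: "\<phi> m (x n) = 0" if "m < n" for m n
    using h[of n] that by (auto simp: P_def x_def \<phi>_def split: prod.splits)
  have coeff: "\<bar>a k\<bar> \<le> 2 ^ k * norm (\<Sum>j<N. a j *\<^sub>R x j)" if "k < N" for N a k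
    using that
  proof (induction k rule: less_induct)
    case (less k)
    let ?s = "\<Sum>j<N. a j *\<^sub>R x j"
    have "\<phi> k ?s = (\<Sum>j<N. a j * \<phi> k (x j))"
      by (simp add: \<phi>_def blinfun.sum_right blinfun.scaleR_right)
    \<comment> \<open>\<open>\<phi> k\<close> vanishes on all later vectors, so the system of
      equations for the coefficients is triangular.\<close>
    also have "\<dots> = (\<Sum>j<Suc k. a j * \<phi> k (x j))"
      using less.prems zero by (intro sum.mono_neutral_right) auto
    also have "\<dots> = (\<Sum>j<k. a j * \<phi> k (x j)) + a k" using x(4) by simp
    finally have "\<bar>a k\<bar> \<le> \<bar>\<phi> k ?s\<bar> + \<bar>\<Sum>j<k. a j * \<phi> k (x j)\<bar>" by linarith
    also have "\<bar>\<Sum>j<k. a j * \<phi> k (x j)\<bar> \<le> (\<Sum>j<k. 2 ^ j * norm ?s)"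
    proof (rule order_trans[OF sum_abs sum_mono])
      fix j assume j: "j \<in> {..<k}"
      have "\<bar>a j * \<phi> k (x j)\<bar> \<le> \<bar>a j\<bar> * 1"
        unfolding abs_mult using \<phi>[of k "x j"] x(2) by (intro mult_left_mono) auto
      then show "\<bar>a j * \<phi> k (x j)\<bar> \<le> 2 ^ j * norm ?s" using less.IH[of j] less.prems j by auto
    qed
    also have "\<bar>\<phi> k ?s\<bar> \<le> norm ?s" by (rule \<phi>)
    finally have "\<bar>a k\<bar> \<le> (1 + (\<Sum>j<k. 2 ^ j)) * norm ?s"
      by (simp add: distrib_right sum_distrib_right)
    then show ?case by (simp only: sum_pow2)
  qed
  have "range x \<subseteq> G" using x by auto
  moreover have "\<not> fin_dim (span (range x))"
  proof (rule not_fin_dim_span_range)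
    fix N k and a :: "nat \<Rightarrow> real"
    assume "(\<Sum>j<N. a j *\<^sub>R x j) = 0" "k < N"
    then show "a k = 0" using coeff[of k N a] by simp
  qed
  moreover have "compact_on (closure (span (range x))) T"
  proof (rule compact_on_closure_span_range[OF T])
    show "\<bar>a k\<bar> \<le> 2 ^ k * norm (\<Sum>j<N. a j *\<^sub>R x j)" if "k < N" for N a k
      using that by (rule coeff)
    show "summable (\<lambda>k. 2 ^ k * norm (T (x k)))"
    proof (rule summable_comparison_test')
      show "summable (\<lambda>k. (1/2::real) ^ k)" by (intro summable_geometric) simp
      show "norm (2 ^ k * norm (T (x k))) \<le> (1/2) ^ k" for k
      proof -
        have "2 ^ k * norm (T (x k)) \<le> 2 ^ k * (1/4) ^ k"
          using x(3) by (intro mult_left_mono less_imp_le) auto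
        also have "\<dots> = (1/2::real) ^ k" by (simp flip: power_mult_distrib)
        finally show ?thesis by simp
      qed
    qed
  qed simp
  ultimately show thesis using that by blast
qed

text \<open>By Baire's theorem the image of some ball has interior in the range, which is therefore locally
  compact.\<close>

lemma compact_on_closed_range_fin_dim:
  fixes T :: "'a::real_normed_vector \<Rightarrow> 'e::banach"
  assumes T: "bounded_linear T" and G: "subspace G" and cpt: "compact_on G T"
    and cl: "closed (T ` G)"
  shows "fin_dim (T ` G)"
proof -
  interpret T: bounded_linear T by fact
  define Y where "Y = T ` G"
  have Y: "subspace Y" unfolding Y_def by (intro T.linear_axioms linear_subspace_image G)
  define K where "K n = closure (T ` (G \<inter> cball 0 (real (Suc n))))" for n
  have K: "compact (K n)" for n
  proof -
    define c where "c = real (Suc n)"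
    have "c > 0" by (simp add: c_def)
    let ?C = "(*\<^sub>R) c ` closure (T ` (G \<inter> cball 0 1))"
    have "T ` (G \<inter> cball 0 c) \<subseteq> ?C"
    proof safe
      fix x assume x: "x \<in> G" "x \<in> cball 0 c"
      have "norm (x /\<^sub>R c) \<le> 1"
        using x(2) \<open>c > 0\<close> by (simp add: field_simps)
      then have "x /\<^sub>R c \<in> G \<inter> cball 0 1"
        using subspace_scale[OF G x(1), of "inverse c"] by simp
      then have "T (x /\<^sub>R c) \<in> closure (T ` (G \<inter> cball 0 1))"
        by (intro subsetD[OF closure_subset] imageI)
      then have "c *\<^sub>R T (x /\<^sub>R c) \<in> ?C" by (rule imageI)
      then show "T x \<in> ?C" using \<open>c > 0\<close> by (simp add: T.scaleR)
    qed
    moreover have "compact ?C"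
      using cpt unfolding compact_on_def by (rule compact_scaling)
    ultimately show ?thesis
      unfolding K_def c_def[symmetric] by (rule compact_closure_if_subset)
  qed
  have "Y \<subseteq> (\<Union>n. K n)"
  proof
    fix y assume "y \<in> Y"
    then obtain x where x: "x \<in> G" "y = T x" by (auto simp: Y_def)
    obtain n where "norm x \<le> real n" using real_arch_simple by blast
    then have "x \<in> G \<inter> cball 0 (real (Suc n))" using x(1) by simp
    then have "y \<in> K n"
      unfolding K_def x(2) by (intro subsetD[OF closure_subset] imageI)
    then show "y \<in> (\<Union>n. K n)" by (rule UN_I[OF UNIV_I])
  qed
  then have Un: "\<Union>(range (\<lambda>n. Y \<inter> K n)) = Y" by auto
  have "\<exists>n. top_of_set Y interior_of (Y \<inter> K n) \<noteq> {}"
  proof (rule ccontr)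
    assume "\<not> ?thesis"
    \<comment> \<open>Here the closed range matters: it makes \<open>Y\<close> completely
      metrizable, so countably many relatively closed sets without interior cannot cover it.\<close>
    then have "top_of_set Y interior_of \<Union>(range (\<lambda>n. Y \<inter> K n)) = {}"
      using cl K by (intro Baire_category_alt disjI1 completely_metrizable_space_closedin
            completely_metrizable_space_euclidean)
          (auto simp: Y_def[symmetric] closedin_closed_Int compact_imp_closed)
    then have "Y = {}" unfolding Un using interior_of_topspace[of "top_of_set Y"] by simp
    then show False using Y subspace_0 by auto
  qed
  then obtain n y where "y \<in> top_of_set Y interior_of (Y \<inter> K n)" by blast
  then obtain U where "openin (top_of_set Y) U" "y \<in> U" "U \<subseteq> K n"
    by (auto simp: interior_of_def)
  then obtain r where r: "r > 0" "y \<in> Y" "ball y r \<inter> Y \<subseteq> K n"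
    unfolding openin_contains_ball by (meson order_trans subsetD)
  \<comment> \<open>Scaling by \<open>r / 2\<close> sends the closed unit ball of \<open>Y\<close>
    into the open ball of radius \<open>r\<close>, hence into the compact translate
    \<open>K n - y\<close>. This multiple of the identity is thus both compact and bounded below on
    \<open>Y\<close>.\<close>
  have "compact_on Y (\<lambda>z. (r / 2) *\<^sub>R z)"
    unfolding compact_on_def
  proof -
    let ?D = "(\<lambda>z. z - y) ` K n"
    have "(\<lambda>z. (r / 2) *\<^sub>R z) ` (Y \<inter> cball 0 1) \<subseteq> ?D"
    proof safe
      fix z assume z: "z \<in> Y" "z \<in> cball 0 1"
      have "y + (r / 2) *\<^sub>R z \<in> Y" using Y r(2) z(1) by (intro subspace_add subspace_scale)
      moreover have "y + (r / 2) *\<^sub>R z \<in> ball y r"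
      proof -
        have "r / 2 * norm z \<le> r / 2 * 1" using z r by (intro mult_left_mono) auto
        then show ?thesis using r by (simp add: dist_norm)
      qed
      ultimately have "y + (r / 2) *\<^sub>R z \<in> K n" using r(3) by blast
      then show "(r / 2) *\<^sub>R z \<in> ?D" by force
    qed
    moreover have "compact ?D" using K by (rule compact_translation_subtract)
    ultimately show "compact (closure ((\<lambda>z. (r / 2) *\<^sub>R z) ` (Y \<inter> cball 0 1)))"
      by (rule compact_closure_if_subset)
  qed
  moreover have "bounded_below_on Y (\<lambda>z. (r / 2) *\<^sub>R z)"
    unfolding bounded_below_on_def using r(1) by (intro exI[of _ "r / 2"]) simp
  moreover have "linear (\<lambda>z::'e. (r / 2) *\<^sub>R z)" by (intro linear_compose_scale_right linear_ident)
  ultimately have "fin_dim Y" using fin_dim_if_compact_bounded_below Y by blast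
  then show ?thesis by (simp add: Y_def)
qed

section \<open>Closed subspaces and upper semi-Fredholm operators\<close>

lemma subspace_closure:
  fixes S :: "'a::real_normed_vector set"
  assumes "subspace S"
  shows "subspace (closure S)"
  unfolding subspace_def
proof (intro conjI ballI allI)
  show "0 \<in> closure S" using assms closure_subset subspace_0 by blast
next
  fix x y assume "x \<in> closure S" "y \<in> closure S"
  then obtain f g where "\<And>n::nat. f n \<in> S" "f \<longlonglongrightarrow> x" "\<And>n::nat. g n \<in> S" "g \<longlonglongrightarrow> y"
    unfolding closure_sequential by metis
  then show "x + y \<in> closure S"
    unfolding closure_sequential using assms
    by (intro exI[of _ "\<lambda>n. f n + g n"]) (auto intro: tendsto_add subspace_add)
next
  fix c x assume "x \<in> closure S"
  then obtain f where "\<And>n::nat. f n \<in> S" "f \<longlonglongrightarrow> x"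
    unfolding closure_sequential by metis
  then show "c *\<^sub>R x \<in> closure S"
    unfolding closure_sequential using assms
    by (intro exI[of _ "\<lambda>n. c *\<^sub>R f n"]) (auto intro: tendsto_scaleR subspace_scale)
qed

lemma closed_subspace_closure_span: "closed_subspace (closure (span X))"
  by (simp add: closed_subspace_def subspace_closure)

lemma closure_span_minimal:
  "X \<subseteq> G \<Longrightarrow> closed_subspace G \<Longrightarrow> closure (span X) \<subseteq> G"
  by (simp add: closed_subspace_def closure_minimal span_minimal)

lemma in_closure_span: "x \<in> X \<Longrightarrow> x \<in> closure (span X)"
  by (rule subsetD[OF closure_subset]) (rule span_base)

text \<open>The kernel meets \<open>K\<close> only in 0, so it embeds into the finite-dimensional
  quotient. The image of \<open>K\<close> is complete, and the image of \<open>G\<close> exceeds it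
  by a finite-dimensional space, which preserves closedness.\<close>

lemma upper_semi_fredholm_if_finite_codim:
  fixes T :: "'a::banach \<Rightarrow> 'b::banach"
  assumes T: "bounded_linear T" and G: "subspace G" and K: "closed_subspace K" "K \<subseteq> G"
    and B: "finite B" "B \<subseteq> G" "G \<subseteq> span (B \<union> K)" and bb: "bounded_below_on K T"
  shows "upper_semi_fredholm_on G T"
  unfolding upper_semi_fredholm_on_def
proof
  interpret T: bounded_linear T by fact
  have sK: "subspace K" and cK: "closed K" using K by (auto simp: closed_subspace_def)
  obtain c where c: "c > 0" "\<And>x. x \<in> K \<Longrightarrow> c * norm x \<le> norm (T x)"
    using bb by (auto simp: bounded_below_on_def)
  let ?N = "{x \<in> G. T x = 0}"
  have "x = 0" if "x \<in> K" "T x = 0" for x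
    using c(2)[OF that(1)] c(1) that(2) by (simp add: mult_le_0_iff)
  then have "?N \<inter> K \<subseteq> span {}" by auto
  then have "fin_dim (?N \<inter> K)" unfolding fin_dim_def by (intro exI[of _ "{}"]) simp
  moreover have "subspace ?N"
    using G by (auto simp: subspace_def T.zero T.add T.scaleR)
  moreover have "?N \<subseteq> span (B \<union> K)" using B(3) by auto
  ultimately show "fin_dim ?N" using fin_dim_if_fin_dim_Int[OF B(1) _ sK] by blast
  have cpl: "complete (T ` K)"
    using c cK by (intro complete_isometric_image[OF c(1) sK T]) (auto simp: complete_eq_closed)
  have "span (T ` K) = T ` K"
    using linear_subspace_image[OF T.linear_axioms sK] by (simp add: span_eq_iff)
  then have "closed (span (T ` K))" using cpl by (simp only: complete_eq_closed)
  then have "closed (span (T ` B \<union> T ` K))"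
    using B(1) by (intro closed_span_Un_finite) auto
  moreover have "G = span (B \<union> K)"
    using B K G by (intro antisym span_minimal) auto
  ultimately show "closed (T ` G)"
    by (simp add: image_Un flip: linear_span_image[OF T.linear_axioms])
qed

text \<open>Each functional that is nonzero on the current common kernel costs one further vector
  \<open>h\<close>, subtracted with the ratio of the two values.\<close>

lemma span_kernel_functionals:
  fixes \<Phi> :: "('a::real_normed_vector \<Rightarrow>\<^sub>L real) set"
  assumes "finite \<Phi>" "subspace G"
  obtains B where "finite B" "B \<subseteq> G" "G \<subseteq> span (B \<union> {x \<in> G. \<forall>\<phi>\<in>\<Phi>. blinfun_apply \<phi> x = 0})"
proof -
  have "\<exists>B. finite B \<and> B \<subseteq> G \<and> G \<subseteq> span (B \<union> {x \<in> G. \<forall>\<phi>\<in>\<Phi>. blinfun_apply \<phi> x = 0})"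
    using assms(1)
  proof (induction rule: finite_induct)
    case empty
    show ?case by (intro exI[of _ "{}"]) (auto intro: span_base)
  next
    case (insert \<phi> \<Phi>)
    let ?K = "{x \<in> G. \<forall>\<phi>\<in>\<Phi>. blinfun_apply \<phi> x = 0}"
    let ?K' = "{x \<in> G. \<forall>\<psi>\<in>insert \<phi> \<Phi>. blinfun_apply \<psi> x = 0}"
    obtain B where B: "finite B" "B \<subseteq> G" "G \<subseteq> span (B \<union> ?K)" using insert.IH by blast
    show ?case
    proof (cases "\<forall>x\<in>?K. blinfun_apply \<phi> x = 0")
      case True
      then have "?K' = ?K" by auto
      then show ?thesis using B by auto
    next
      case False
      then obtain h where h: "h \<in> ?K" "blinfun_apply \<phi> h \<noteq> 0" by blast
      have "x \<in> span (insert h B \<union> ?K')" if x: "x \<in> ?K" for x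
      proof -
        define t where "t = blinfun_apply \<phi> x / blinfun_apply \<phi> h"
        have "x - t *\<^sub>R h \<in> ?K'"
          using x h assms(2)
          by (simp add: t_def blinfun.diff_right blinfun.scaleR_right subspace_diff subspace_scale)
        then have "x - t *\<^sub>R h \<in> span (B \<union> ?K')" by (intro span_base) simp
        then show ?thesis by (auto simp: span_breakdown_eq)
      qed
      moreover have "B \<subseteq> span (insert h B \<union> ?K')" by (auto intro: span_base)
      ultimately have "span (B \<union> ?K) \<subseteq> span (insert h B \<union> ?K')"
        by (intro span_minimal subspace_span Un_least subsetI) auto
      then show ?thesis
        using B h by (intro exI[of _ "insert h B"]) auto
    qed
  qed
  then show thesis using that by blast
qed

text \<open>If unit vectors with image below \<open>e\<close> were missing from the common kernel of
  some finite \<open>\<Phi>\<close>, then \<open>T\<close> would be bounded below by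
  \<open>e\<close> on a closed subspace of finite codimension and so be upper semi-Fredholm. Hence
  Kato's construction can always continue.\<close>

lemma compact_on_subspace_if_not_fredholm:
  fixes T :: "'a::banach \<Rightarrow> 'b::banach"
  assumes T: "bounded_linear T" and G: "closed_subspace G"
    and not: "\<not> upper_semi_fredholm_on G T"
  obtains H where "closed_subspace H" "H \<subseteq> G" "\<not> fin_dim H" "compact_on H T"
proof -
  interpret T: bounded_linear T by fact
  have sG: "subspace G" and cG: "closed G" using G by (auto simp: closed_subspace_def)
  have small: "\<exists>x\<in>G. norm x = 1 \<and> norm (T x) < e \<and> (\<forall>\<phi>\<in>\<Phi>. blinfun_apply \<phi> x = (0::real))"
    if \<Phi>: "finite \<Phi>" and e: "0 < e" for \<Phi> e
  proof (rule ccontr)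
    assume no: "\<not> ?thesis"
    let ?K = "{x \<in> G. \<forall>\<phi>\<in>\<Phi>. blinfun_apply \<phi> x = 0}"
    have "?K = G \<inter> (\<Inter>\<phi>\<in>\<Phi>. {x. blinfun_apply \<phi> x = 0})" by auto
    moreover have "closed (G \<inter> (\<Inter>\<phi>\<in>\<Phi>. {x. blinfun_apply \<phi> x = 0}))"
      by (intro closed_Int closed_INT ballI cG closed_Collect_eq continuous_intros)
    ultimately have cK: "closed ?K" by simp
    have sK: "subspace ?K"
      using sG by (auto simp: subspace_def blinfun.add_right blinfun.scaleR_right)
    have "e * norm x \<le> norm (T x)" if x: "x \<in> ?K" for x
    proof (cases "x = 0")
      case False
      define y where "y = x /\<^sub>R norm x"
      have "y \<in> ?K" unfolding y_def using sK x by (rule subspace_scale)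
      moreover have "norm y = 1" using False by (simp add: y_def)
      ultimately have "e \<le> norm (T y)" using no by force
      then show ?thesis using False by (simp add: y_def T.scaleR field_simps)
    qed (simp add: T.zero)
    then have "bounded_below_on ?K T" using e by (auto simp: bounded_below_on_def)
    moreover obtain B where "finite B" "B \<subseteq> G" "G \<subseteq> span (B \<union> ?K)"
      using span_kernel_functionals[OF \<Phi> sG] by blast
    ultimately have "upper_semi_fredholm_on G T"
      using sK cK by (intro upper_semi_fredholm_if_finite_codim[OF T sG, of ?K B])
        (auto simp: closed_subspace_def)
    then show False using not by blast
  qed
  obtain x :: "nat \<Rightarrow> 'a" where x: "range x \<subseteq> G" "\<not> fin_dim (span (range x))"
      "compact_on (closure (span (range x))) T"
    using compact_on_subspace_if_small[OF T small] by blast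
  show thesis
  proof (rule that)
    show "closed_subspace (closure (span (range x)))" by (rule closed_subspace_closure_span)
    show "closure (span (range x)) \<subseteq> G" using x(1) G by (rule closure_span_minimal)
    show "\<not> fin_dim (closure (span (range x)))"
      using x(2) fin_dim_subset closure_subset by blast
  qed fact
qed

lemma strictly_singular_if_compact:
  fixes T :: "'a::real_normed_vector \<Rightarrow> 'b::real_normed_vector"
  assumes "linear T" "compact_on G T"
  shows "strictly_singular_on G T"
  unfolding strictly_singular_on_def using fin_dim_if_compact_bounded_below[OF assms(1)] assms(2) by blast

section \<open>Disjointly non-singular operators\<close>

definition disjointly_nonsingular :: "('f::banach_lattice \<Rightarrow> 'e::real_normed_vector) \<Rightarrow> bool" where
  "disjointly_nonsingular T \<longleftrightarrow>
     \<not> (\<exists>f. (\<forall>n. norm (f n) = 1) \<and> disjoint_seq f \<and> (\<lambda>n. norm (T (f n))) \<longlonglongrightarrow> 0)"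

text \<open>The right side is already closed, being a closed subspace enlarged by finitely many
  vectors, and it contains every \<open>f n\<close>. So closed tail spans have finite
  codimension.\<close>

lemma closure_span_range_tail:
  fixes f :: "nat \<Rightarrow> 'a::real_normed_vector"
  shows "closure (span (range f)) \<subseteq> span (f ` {..<m} \<union> closure (span (f ` {m..})))"
proof (rule closure_span_minimal)
  show "range f \<subseteq> span (f ` {..<m} \<union> closure (span (f ` {m..})))"
  proof safe
    fix n
    show "f n \<in> span (f ` {..<m} \<union> closure (span (f ` {m..})))"
      by (cases "n < m") (auto intro!: span_base in_closure_span)
  qed
  have "span (closure (span (f ` {m..}))) = closure (span (f ` {m..}))"
    by (simp add: span_eq_iff subspace_closure)
  then have "closed (span (closure (span (f ` {m..}))))"
    by (simp only: closed_closure)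
  then show "closed_subspace (span (f ` {..<m} \<union> closure (span (f ` {m..}))))"
    by (simp add: closed_subspace_def closed_span_Un_finite)
qed

text \<open>An infinite-dimensional \<open>H\<close> meets every closed tail span in a nonzero
  vector, because tails have finite codimension; this supplies the gliding hump with unit vectors of
  \<open>H\<close>.\<close>

lemma anti_dispersed_closure_span_disjoint:
  fixes f :: "nat \<Rightarrow> 'f::banach_lattice"
  assumes f: "disjoint_seq f"
  shows "anti_dispersed (closure (span (range f)))"
  unfolding anti_dispersed_def
proof (intro conjI notI; (elim exE conjE)?)
  show "closed_subspace (closure (span (range f)))" by (rule closed_subspace_closure_span)
  fix H assume H: "closed_subspace H" "H \<subseteq> closure (span (range f))" "\<not> fin_dim H" "dispersed H"
  have sH: "subspace H" using H(1) by (simp add: closed_subspace_def)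
  have "\<exists>e. (e \<in> H \<and> norm e = 1) \<and> e \<in> closure (span (f ` {m..}))" for m
  proof -
    let ?K = "closure (span (f ` {m..}))"
    have "H \<subseteq> span (f ` {..<m} \<union> ?K)"
      using H(2) closure_span_range_tail[of f m] by (rule order_trans)
    then have "\<not> fin_dim (H \<inter> ?K)"
      using H(3) fin_dim_if_fin_dim_Int[of "f ` {..<m}" H ?K] sH by (auto simp: subspace_closure)
    then have "\<not> H \<inter> ?K \<subseteq> span {}" unfolding fin_dim_def by blast
    then obtain x where x: "x \<in> H" "x \<in> ?K" "x \<noteq> 0" by auto
    have "x /\<^sub>R norm x \<in> H" using sH x(1) by (rule subspace_scale)
    moreover have "x /\<^sub>R norm x \<in> ?K"
      using subspace_closure[OF subspace_span] x(2) by (rule subspace_scale)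
    ultimately show ?thesis using x(3) by (intro exI[of _ "x /\<^sub>R norm x"]) simp
  qed
  then obtain e g where "\<And>k. e k \<in> H \<and> norm (e k) = 1" "disjoint_seq g" "(\<lambda>n. norm (g n - e n)) \<longlonglongrightarrow> 0"
    using gliding_hump[OF f, of "\<lambda>k e. e \<in> H \<and> norm e = 1"] by metis
  then have "almost_disjoint_in H e" by (auto simp: almost_disjoint_in_def)
  then show False using H(4) by (auto simp: dispersed_def)
qed

lemma not_dispersed_if_disjoint:
  assumes "disjoint_seq f" "\<And>n. f n \<noteq> 0" "subspace G" "range f \<subseteq> G"
  shows "\<not> dispersed G"
proof -
  define e where "e n = inverse (norm (f n)) *\<^sub>R f n" for n
  have "disjoint_seq e" unfolding e_def by (intro disjoint_seq_scaleR assms)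
  moreover have "e n \<in> G" "norm (e n) = 1" for n
    using assms(2,4) by (auto simp: e_def intro!: subspace_scale[OF assms(3)])
  ultimately have "almost_disjoint_in G e"
    unfolding almost_disjoint_in_def by (intro conjI allI exI[of _ e]) auto
  then show ?thesis by (auto simp: dispersed_def)
qed

text \<open>The disjoint approximants have images tending to 0 by continuity, and normalising them
  yields a sequence forbidden by (i).\<close>

lemma disjointly_nonsingular_not_tendsto_0:
  fixes T :: "'f::banach_lattice \<Rightarrow> 'e::real_normed_vector"
  assumes T: "bounded_linear T" and dns: "disjointly_nonsingular T"
    and f: "almost_disjoint_in UNIV f"
  shows "\<not> (\<lambda>n. norm (T (f n))) \<longlonglongrightarrow> 0"
proof
  assume Tf: "(\<lambda>n. norm (T (f n))) \<longlonglongrightarrow> 0"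
  interpret T: bounded_linear T by fact
  obtain g where g: "disjoint_seq g" "(\<lambda>n. norm (g n - f n)) \<longlonglongrightarrow> 0" and nf: "\<And>n. norm (f n) = 1"
    using f by (auto simp: almost_disjoint_in_def)
  \<comment> \<open>Early approximants may vanish; from \<open>N\<close> on their norm is at least
    1/2, so normalising at most doubles the images.\<close>
  obtain N where N: "\<And>n. n \<ge> N \<Longrightarrow> norm (g n - f n) < 1/2"
    using order_tendstoD(2)[OF g(2), of "1/2"] by (auto simp: eventually_sequentially)
  have ng: "1/2 \<le> norm (g n)" if "n \<ge> N" for n
    using N[OF that] nf[of n] norm_triangle_ineq2[of "f n" "f n - g n"]
    by (simp add: norm_minus_commute)
  define h where "h n = inverse (norm (g (n + N))) *\<^sub>R g (n + N)" for n
  have "(\<lambda>n. T (g n - f n)) \<longlonglongrightarrow> T 0"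
    using g(2) by (intro T.tendsto) (simp add: tendsto_norm_zero_iff)
  moreover have "(\<lambda>n. T (f n)) \<longlonglongrightarrow> 0" using Tf by (simp add: tendsto_norm_zero_iff)
  ultimately have "(\<lambda>n. T (g n - f n) + T (f n)) \<longlonglongrightarrow> T 0 + 0" by (rule tendsto_add)
  then have "(\<lambda>n. T (g n)) \<longlonglongrightarrow> 0" by (simp add: T.diff T.zero)
  then have "(\<lambda>n. T (g (n + N))) \<longlonglongrightarrow> 0" by (rule LIMSEQ_ignore_initial_segment)
  then have lim: "(\<lambda>n. 2 * norm (T (g (n + N)))) \<longlonglongrightarrow> 0"
    by (intro tendsto_mult_right_zero tendsto_norm_zero)
  have "(\<lambda>n. norm (T (h n))) \<longlonglongrightarrow> 0"
  proof (rule Lim_null_comparison[OF _ lim])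
    have "norm (T (h n)) \<le> 2 * norm (T (g (n + N)))" for n
    proof -
      have "inverse (norm (g (n + N))) \<le> inverse (1/2)"
        using ng[of "n + N"] by (intro le_imp_inverse_le) auto
      then have "inverse (norm (g (n + N))) * norm (T (g (n + N))) \<le> 2 * norm (T (g (n + N)))"
        by (intro mult_right_mono) auto
      then show ?thesis by (simp add: h_def T.scaleR)
    qed
    then show "\<forall>\<^sub>F n in sequentially. norm (norm (T (h n))) \<le> 2 * norm (T (g (n + N)))" by simp
  qed
  moreover have "disjoint_seq (\<lambda>n. g (n + N))"
    by (rule disjoint_seq_subseq[OF g(1)]) (simp add: inj_def)
  then have "disjoint_seq h" unfolding h_def by (rule disjoint_seq_scaleR)
  moreover have "norm (h n) = 1" for n
  proof -
    have "norm (g (n + N)) \<noteq> 0" using ng[of "n + N"] by linarith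
    then show ?thesis by (simp add: h_def)
  qed
  ultimately show False using dns unfolding disjointly_nonsingular_def by blast
qed

text \<open>If every tail fails, each contains unit vectors with arbitrarily small image. The
  gliding hump makes them almost disjoint while the images tend to 0.\<close>

lemma disjointly_nonsingular_bounded_below_tail:
  fixes T :: "'f::banach_lattice \<Rightarrow> 'e::real_normed_vector"
  assumes T: "bounded_linear T" and dns: "disjointly_nonsingular T" and f: "disjoint_seq f"
  shows "\<exists>m. bounded_below_on (closure (span (f ` {m..}))) T"
proof (rule ccontr)
  assume no: "\<not> ?thesis"
  interpret T: bounded_linear T by fact
  have "\<exists>e. (norm e = 1 \<and> norm (T e) < inverse (real (Suc k))) \<and> e \<in> closure (span (f ` {m..}))" for m k
  proof -
    have "\<not> (\<forall>x\<in>closure (span (f ` {m..})). inverse (real (Suc k)) * norm x \<le> norm (T x))"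
      using no unfolding bounded_below_on_def
      by (metis inverse_positive_iff_positive of_nat_0_less_iff zero_less_Suc)
    then obtain x where x: "x \<in> closure (span (f ` {m..}))" "norm (T x) < inverse (real (Suc k)) * norm x"
      by (auto simp: not_le)
    then have "x \<noteq> 0" by (auto simp: T.zero)
    define e where "e = inverse (norm x) *\<^sub>R x"
    have "norm e = 1" using \<open>x \<noteq> 0\<close> by (simp add: e_def)
    moreover have "norm (T e) < inverse (real (Suc k))"
    proof -
      have "norm (T e) = norm (T x) / norm x" by (simp add: e_def T.scaleR divide_inverse_commute)
      also have "\<dots> < inverse (real (Suc k))"
        using x(2) \<open>x \<noteq> 0\<close> by (subst pos_divide_less_eq) auto
      finally show ?thesis .
    qed
    moreover have "e \<in> closure (span (f ` {m..}))"
      unfolding e_def using subspace_closure[OF subspace_span] x(1) by (rule subspace_scale)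
    ultimately show ?thesis by blast
  qed
  then obtain e g where e: "\<And>k. norm (e k) = 1 \<and> norm (T (e k)) < inverse (real (Suc k))"
    and g: "disjoint_seq g" "(\<lambda>n. norm (g n - e n)) \<longlonglongrightarrow> 0"
    using gliding_hump[OF f, of "\<lambda>k e. norm e = 1 \<and> norm (T e) < inverse (real (Suc k))"] by metis
  have "(\<lambda>n. norm (T (e n))) \<longlonglongrightarrow> 0"
    by (rule tendsto_sandwich[OF _ _ tendsto_const LIMSEQ_inverse_real_of_nat])
       (use e in \<open>auto intro!: always_eventually less_imp_le\<close>)
  moreover have "almost_disjoint_in UNIV e"
    using e g by (auto simp: almost_disjoint_in_def)
  ultimately show False
    using disjointly_nonsingular_not_tendsto_0[OF T dns] by blast
qed

lemma sum_half_powers_le: "(\<Sum>k<N. (1/2::real) ^ k) \<le> 2"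
proof -
  have "(\<Sum>k<N. (1/2::real) ^ k) = 2 - 2 * (1/2) ^ N"
    by (induction N) simp_all
  then show ?thesis by simp
qed

text \<open>Principle of small perturbations: lower boundedness of \<open>T\<close> on the span of a
  disjoint tail is carried over to the span of vectors \<open>x n\<close> of \<open>G\<close> close
  to that tail. The algebraic span suffices, since strict singularity tests all subspaces.\<close>

lemma disjointly_nonsingular_not_strictly_singular:
  fixes T :: "'f::banach_lattice \<Rightarrow> 'e::real_normed_vector"
  assumes T: "bounded_linear T" and dns: "disjointly_nonsingular T"
    and G: "subspace G" "\<not> dispersed G"
  shows "\<not> strictly_singular_on G T"
proof -
  interpret T: bounded_linear T by fact
  obtain e g where e: "\<And>n. e n \<in> G" "\<And>n. norm (e n) = 1"
    and g: "disjoint_seq g" "(\<lambda>n. norm (g n - e n)) \<longlonglongrightarrow> 0"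
    using G(2) by (auto simp: dispersed_def almost_disjoint_in_def)
  obtain m c where c: "c > 0" "\<And>x. x \<in> closure (span (g ` {m..})) \<Longrightarrow> c * norm x \<le> norm (T x)"
    using disjointly_nonsingular_bounded_below_tail[OF T dns g(1)] by (auto simp: bounded_below_on_def)
  obtain K where K: "K > 0" "\<And>z. norm (T z) \<le> norm z * K" using T.pos_bounded by auto
  \<comment> \<open>Combinations move by at most a factor \<open>4 * \<delta>\<close>. The bound 1/8
    makes this at most 1/2, and \<open>c / (8 * K)\<close> makes the resulting change under
    \<open>T\<close> at most half of the lower bound \<open>c\<close>.\<close>
  define \<delta> where "\<delta> = min (1/8) (c / (8 * K))"
  have \<delta>: "\<delta> > 0" "\<delta> \<le> 1/8" "8 * \<delta> * K \<le> c"
    using c K by (auto simp: \<delta>_def min_def field_simps)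
  have "(\<lambda>n. norm (g (n + m) - e (n + m))) \<longlonglongrightarrow> 0"
    using LIMSEQ_ignore_initial_segment[OF g(2)] .
  \<comment> \<open>The shift by \<open>m\<close> puts the approximants into the tail where
    \<open>T\<close> is bounded below; the factors \<open>(1/2) ^ n\<close> make the errors
    summable.\<close>
  then obtain r where r: "strict_mono r" "\<And>n. norm (g (r n + m) - e (r n + m)) < \<delta> * (1/2) ^ n"
    using subseq_below[of "\<lambda>n. norm (g (n + m) - e (n + m))" "\<lambda>n. \<delta> * (1/2) ^ n"] \<delta>(1) by auto
  define x where "x n = e (r n + m)" for n
  define y where "y n = g (r n + m)" for n
  have "inj (\<lambda>n. r n + m)" using r(1) by (simp add: inj_def strict_mono_eq)
  then have y: "disjoint_seq y" unfolding y_def by (rule disjoint_seq_subseq[OF g(1)])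
  have yx: "norm (y n - x n) \<le> \<delta> * (1/2) ^ n" for n
    using r(2)[of n] by (simp add: x_def y_def)
  have ny: "1/2 \<le> norm (y n)" for n
  proof -
    have "\<delta> * (1/2) ^ n \<le> 1/8 * 1"
      using \<delta> by (intro mult_mono power_le_one) auto
    then have "norm (y n - x n) \<le> 1/8" using yx[of n] by linarith
    moreover have "norm (x n) = 1" by (simp add: x_def e)
    ultimately show ?thesis using norm_triangle_ineq2[of "x n" "x n - y n"]
      by (simp add: norm_minus_commute)
  qed
  have coeff: "\<bar>a k\<bar> \<le> 2 * norm (\<Sum>j<N. a j *\<^sub>R y j)" if "k < N" for a N k
  proof -
    have "\<bar>a k\<bar> * (1/2) \<le> \<bar>a k\<bar> * norm (y k)" by (intro mult_left_mono ny) simp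
    also have "\<dots> = norm (a k *\<^sub>R y k)" by simp
    also have "\<dots> \<le> norm (\<Sum>j<N. a j *\<^sub>R y j)"
      using that by (intro disjoint_seq_norm_coeff_le[OF y]) auto
    finally show ?thesis by simp
  qed
  \<comment> \<open>The factor 4 is 2 from \<open>coeff\<close> times 2 from the geometric
    series.\<close>
  have diff: "norm ((\<Sum>j<N. a j *\<^sub>R y j) - (\<Sum>j<N. a j *\<^sub>R x j)) \<le> 4 * \<delta> * norm (\<Sum>j<N. a j *\<^sub>R y j)" for a N
  proof -
    let ?t = "norm (\<Sum>j<N. a j *\<^sub>R y j)"
    have "(\<Sum>j<N. a j *\<^sub>R y j) - (\<Sum>j<N. a j *\<^sub>R x j) = (\<Sum>j<N. a j *\<^sub>R (y j - x j))"
      by (simp add: sum_subtractf scaleR_right_diff_distrib)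
    also have "norm \<dots> \<le> (\<Sum>j<N. 2 * ?t * (\<delta> * (1/2) ^ j))"
      by (intro sum_norm_le) (auto intro!: mult_mono coeff yx)
    also have "\<dots> = 2 * ?t * \<delta> * (\<Sum>j<N. (1/2) ^ j)"
      by (simp add: sum_distrib_left mult.assoc)
    also have "\<dots> \<le> 2 * ?t * \<delta> * 2"
      using \<delta>(1) by (intro mult_left_mono sum_half_powers_le) auto
    finally show ?thesis by (simp add: mult_ac)
  qed
  let ?H = "span (range x)"
  have "?H \<subseteq> G" using e(1) G(1) by (intro span_minimal) (auto simp: x_def)
  moreover have "\<not> fin_dim ?H"
  proof (rule not_fin_dim_span_range)
    fix N k :: nat and a :: "nat \<Rightarrow> real"
    assume z: "(\<Sum>j<N. a j *\<^sub>R x j) = 0" and k: "k < N"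
    let ?t = "norm (\<Sum>j<N. a j *\<^sub>R y j)"
    have "?t \<le> 4 * \<delta> * ?t" using diff[where a = a and N = N] unfolding z by simp
    also have "\<dots> \<le> 1/2 * ?t" using \<delta>(2) by (intro mult_right_mono) auto
    finally have "?t \<le> 0" by simp
    then show "a k = 0" using coeff[OF k, of a] by simp
  qed
  moreover have "bounded_below_on ?H T"
    unfolding bounded_below_on_def
  \<comment> \<open>From \<open>norm s \<le> 3/2 * norm t\<close> and
    \<open>c * norm t \<le> 2 * norm (T s)\<close>.\<close>
  proof (intro exI[of _ "c / 3"] conjI ballI)
    show "0 < c / 3" using c by simp
    fix s assume "s \<in> ?H"
    then obtain N a where s: "s = (\<Sum>j<N. a j *\<^sub>R x j)" by (rule span_range_eq_sum)
    define t where "t = (\<Sum>j<N. a j *\<^sub>R y j)"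
    have "t \<in> span (g ` {m..})"
      unfolding t_def y_def by (intro span_sum span_scale span_base) auto
    then have "c * norm t \<le> norm (T t)" using closure_subset by (intro c(2)) blast
    also have "\<dots> \<le> norm (T s) + norm (T (t - s))"
      using norm_triangle_ineq[of "T s" "T (t - s)"] by (simp add: T.diff)
    also have "norm (T (t - s)) \<le> norm (t - s) * K" by (rule K)
    also have ts: "norm (t - s) \<le> 4 * \<delta> * norm t" unfolding s t_def by (rule diff)
    finally have "c * norm t \<le> norm (T s) + 4 * \<delta> * norm t * K" using K by simp
    moreover have "8 * \<delta> * K * norm t \<le> c * norm t" using \<delta>(3) by (intro mult_right_mono) auto
    ultimately have 1: "c * norm t \<le> 2 * norm (T s)" by (simp add: mult_ac)
    have "4 * \<delta> * norm t \<le> 1/2 * norm t" using \<delta>(2) by (intro mult_right_mono) auto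
    then have "norm s \<le> 3/2 * norm t"
      using ts norm_triangle_ineq2[of s t] by (simp add: norm_minus_commute)
    then have "c * norm s \<le> c * (3/2 * norm t)" using c(1) by (intro mult_left_mono) auto
    then show "c / 3 * norm s \<le> norm (T s)" using 1 by simp
  qed
  ultimately show ?thesis
    unfolding strictly_singular_on_def using subspace_span by blast
qed

section \<open>Consequences of the failure of (i)\<close>

text \<open>Passing to a subsequence makes the images summable, and coefficients of a normalised
  disjoint sequence are bounded by the norm of the sum. Summability is exported because it also
  drives the compact perturbation below.\<close>

lemma compact_on_disjoint_if_not_dns:
  fixes T :: "'f::banach_lattice \<Rightarrow> 'e::banach"
  assumes T: "bounded_linear T" and "\<not> disjointly_nonsingular T"
  obtains h where "disjoint_seq h" "\<And>n. norm (h n) = 1" "summable (\<lambda>n. norm (T (h n)))"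
    "compact_on (closure (span (range h))) T"
proof -
  obtain f where f: "\<And>n. norm (f n) = 1" "disjoint_seq f" "(\<lambda>n. norm (T (f n))) \<longlonglongrightarrow> 0"
    using assms(2) by (auto simp: disjointly_nonsingular_def)
  obtain r where r: "strict_mono r" "\<And>n. norm (T (f (r n))) < (1/2) ^ n"
    using subseq_below[OF f(3), of "\<lambda>n. (1/2) ^ n"] by auto
  define h where "h n = f (r n)" for n
  have h: "disjoint_seq h" "\<And>n. norm (h n) = 1"
    unfolding h_def
    by (rule disjoint_seq_subseq[OF f(2) strict_mono_imp_inj_on[OF r(1)]]) (rule f(1))
  have summ: "summable (\<lambda>n. norm (T (h n)))"
  proof (rule summable_comparison_test')
    show "summable (\<lambda>k. (1/2::real) ^ k)" by (intro summable_geometric) simp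
    show "norm (norm (T (h n))) \<le> (1/2) ^ n" for n
      using r(2)[of n] by (simp add: h_def)
  qed
  have "compact_on (closure (span (range h))) T"
  proof (rule compact_on_closure_span_range[OF T, where C = "\<lambda>_. 1"])
    fix N k :: nat and a :: "nat \<Rightarrow> real" assume "k < N"
    then show "\<bar>a k\<bar> \<le> 1 * norm (\<Sum>j<N. a j *\<^sub>R h j)"
      using disjoint_seq_norm_coeff_le[OF h(1), of "{..<N}" k a] h(2) by simp
  qed (use summ in auto)
  then show thesis using that h summ by blast
qed

lemma coordinate_functional:
  fixes h :: "nat \<Rightarrow> 'f::banach_lattice"
  assumes h: "disjoint_seq h" "\<And>n. norm (h n) = 1"
  obtains \<phi> :: "'f \<Rightarrow>\<^sub>L real" where "\<And>z. \<bar>blinfun_apply \<phi> z\<bar> \<le> norm z"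
    "\<And>k. blinfun_apply \<phi> (h k) = (if k = n then 1 else 0)"
proof -
  \<comment> \<open>Points of the graph of the \<open>n\<close>-th coordinate on the span;
    domination by the norm is exactly the coefficient estimate for disjoint sequences.\<close>
  define v where "v k = (h k, if k = n then 1 else 0 :: real)" for k
  have bd: "snd p \<le> norm (fst p)" if "p \<in> span (range v)" for p
  proof -
    obtain N a where p: "p = (\<Sum>k<N. a k *\<^sub>R v k)" using \<open>p \<in> span (range v)\<close> by (rule span_range_eq_sum)
    have fst: "fst p = (\<Sum>k<N. a k *\<^sub>R h k)" by (simp add: p v_def fst_sum)
    have "snd p = (\<Sum>k<N. if k = n then a k else 0)"
      unfolding p snd_sum by (intro sum.cong) (auto simp: v_def)
    then have "snd p = (if n < N then a n else 0)" by simp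
    moreover have "a n \<le> norm (fst p)" if "n < N"
      using disjoint_seq_norm_coeff_le[OF h(1), of "{..<N}" n a] h(2) that by (simp add: fst)
    ultimately show ?thesis by simp
  qed
  obtain \<phi> :: "'f \<Rightarrow>\<^sub>L real" where \<phi>: "\<And>z. \<bar>blinfun_apply \<phi> z\<bar> \<le> norm z"
    "\<And>z a. (z, a) \<in> span (range v) \<Longrightarrow> blinfun_apply \<phi> z = a"
    using hahn_banach_graph[OF subspace_span bd] by blast
  have "blinfun_apply \<phi> (h k) = (if k = n then 1 else 0)" for k
    by (rule \<phi>(2)) (fold v_def, rule span_base, rule rangeI)
  then show thesis using that \<phi>(1) by blast
qed

text \<open>The operator \<open>S\<close> is the nuclear series of the rank-one maps sending
  \<open>x\<close> to \<open>\<phi> n x\<close> times \<open>T (h n)\<close>. Biorthogonality makes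
  it agree with \<open>T\<close> on every \<open>h k\<close>, so the kernel of the difference
  contains a normalised disjoint sequence.\<close>

lemma compact_perturbation_if_not_dns:
  fixes T :: "'f::banach_lattice \<Rightarrow> 'e::banach"
  assumes T: "bounded_linear T" and "\<not> disjointly_nonsingular T"
  obtains S where "bounded_linear S" "compact_on UNIV S" "\<not> dispersed {x. T x - S x = 0}"
proof -
  interpret T: bounded_linear T by fact
  obtain h where h: "disjoint_seq h" "\<And>n. norm (h n) = 1" "summable (\<lambda>n. norm (T (h n)))"
    by (rule compact_on_disjoint_if_not_dns[OF assms]) (rule that)
  have "\<exists>\<phi> :: 'f \<Rightarrow>\<^sub>L real. (\<forall>z. \<bar>blinfun_apply \<phi> z\<bar> \<le> norm z) \<and>
    (\<forall>k. blinfun_apply \<phi> (h k) = (if k = n then 1 else 0))" for n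
    by (rule coordinate_functional[OF h(1,2), of n]) (intro exI conjI allI)
  then obtain \<phi> :: "nat \<Rightarrow> 'f \<Rightarrow>\<^sub>L real" where
    "\<And>n. (\<forall>z. \<bar>blinfun_apply (\<phi> n) z\<bar> \<le> norm z) \<and>
      (\<forall>k. blinfun_apply (\<phi> n) (h k) = (if k = n then 1 else 0))"
    by metis
  then have \<phi>: "\<bar>blinfun_apply (\<phi> n) z\<bar> \<le> norm z"
    "blinfun_apply (\<phi> n) (h k) = (if k = n then 1 else 0)" for n z k
    by blast+
  define S where "S x = (\<Sum>n. blinfun_apply (\<phi> n) x *\<^sub>R T (h n))" for x
  have le: "norm (blinfun_apply (\<phi> n) x *\<^sub>R T (h n)) \<le> norm x * norm (T (h n))" for n x
    using \<phi>(1)[of n x] by (simp add: mult_right_mono)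
  have summ': "summable (\<lambda>n. norm x * norm (T (h n)))" for x :: 'f
    using h(3) by (rule summable_mult)
  have summn: "summable (\<lambda>n. norm (blinfun_apply (\<phi> n) x *\<^sub>R T (h n)))" for x
    by (rule summable_comparison_test'[OF summ'[of x], of 0]) (use le in simp)
  have summ: "summable (\<lambda>n. blinfun_apply (\<phi> n) x *\<^sub>R T (h n))" for x
    by (rule summable_norm_cancel[OF summn])
  have S: "bounded_linear S"
  proof (rule bounded_linear_intro)
    show "S (x + y) = S x + S y" for x y
      unfolding S_def suminf_add[OF summ summ] by (simp add: blinfun.add_right scaleR_left_distrib)
    show "S (r *\<^sub>R x) = r *\<^sub>R S x" for r x
      unfolding S_def suminf_scaleR_right[OF summ] by (simp add: blinfun.scaleR_right)
    show "norm (S x) \<le> norm x * (\<Sum>n. norm (T (h n)))" for x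
    proof -
      have "norm (S x) \<le> (\<Sum>n. norm (blinfun_apply (\<phi> n) x *\<^sub>R T (h n)))"
        unfolding S_def by (rule summable_norm[OF summn])
      also have "\<dots> \<le> (\<Sum>n. norm x * norm (T (h n)))"
        by (rule suminf_le[OF le summn summ'])
      also have "\<dots> = norm x * (\<Sum>n. norm (T (h n)))" by (rule suminf_mult[OF h(3)])
      finally show ?thesis .
    qed
  qed
  have "compact_on UNIV S"
    unfolding compact_on_def
  proof (rule compact_closure_if_series[where C = "\<lambda>_. 1" and v = "\<lambda>n. T (h n)"])
    fix y and e :: real assume "y \<in> S ` (UNIV \<inter> cball 0 1)" "0 < e"
    then obtain x where x: "y = S x" "norm x \<le> 1" by auto
    have "(\<lambda>N. \<Sum>k<N. blinfun_apply (\<phi> k) x *\<^sub>R T (h k)) \<longlonglongrightarrow> y"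
      unfolding x(1) S_def by (rule summable_LIMSEQ[OF summ])
    then obtain N where "dist (\<Sum>k<N. blinfun_apply (\<phi> k) x *\<^sub>R T (h k)) y < e"
      using \<open>0 < e\<close> by (meson LIMSEQ_iff_nz metric_LIMSEQ_D order_refl)
    moreover have "\<bar>blinfun_apply (\<phi> k) x\<bar> \<le> 1" for k
      using \<phi>(1)[of k x] x(2) by linarith
    ultimately show "\<exists>N b. (\<forall>k<N. \<bar>b k\<bar> \<le> 1) \<and> dist y (\<Sum>k<N. b k *\<^sub>R T (h k)) < e"
      by (intro exI[of _ N] exI[of _ "\<lambda>k. blinfun_apply (\<phi> k) x"]) (simp add: dist_commute)
  qed (use h(3) in auto)
  moreover have "\<not> dispersed {x. T x - S x = 0}"
  proof (rule not_dispersed_if_disjoint[OF h(1)])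
    show "h n \<noteq> 0" for n using h(2)[of n] by auto
    show "subspace {x. T x - S x = 0}"
      using S T.linear_axioms unfolding bounded_linear_def
      by (auto simp: subspace_def linear_0 linear_add linear_scale)
    have "S (h k) = T (h k)" for k
    proof -
      have "S (h k) = (\<Sum>n. if n = k then T (h k) else 0)"
        unfolding S_def by (intro arg_cong[where f = suminf] ext) (simp add: \<phi>(2))
      also have "\<dots> = T (h k)" 
        by (rule sums_unique[OF sums_single, symmetric])
      finally show ?thesis .
    qed
    then show "range h \<subseteq> {x. T x - S x = 0}" by auto
  qed
  ultimately show thesis using that S by blast
qed

text \<open>A closed range would be finite-dimensional; together with a finite-dimensional kernel
  this would make \<open>G\<close> finite-dimensional.\<close>

lemma not_fredholm_if_compact:
  fixes T :: "'a::real_normed_vector \<Rightarrow> 'e::banach"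
  assumes "bounded_linear T" "subspace G" "compact_on G T" "\<not> fin_dim G"
  shows "\<not> upper_semi_fredholm_on G T"
  using compact_on_closed_range_fin_dim[OF assms(1-3)]
    fin_dim_if_kernel_range[OF bounded_linear.linear[OF assms(1)] assms(2)] assms(4)
  unfolding upper_semi_fredholm_on_def by blast

section \<open>The equivalences\<close>

text \<open>Besides the pair (i) and its almost disjoint form, the implications form cycles through
  (i): (i), (v), (iii), (ii), (i), and (i), (ix), (viii), from which one returns by (ii), by (vi),
  or by (vii) and (iv).\<close>

theorem theorem5p1:
  fixes T :: "'f::banach_lattice \<Rightarrow> 'e::banach"
  assumes "bounded_linear T"
  defines "P1 \<equiv> \<not> (\<exists>f. (\<forall>n. norm (f n) = 1) \<and> disjoint_seq f \<and>
                        (\<lambda>n. norm (T (f n))) \<longlonglongrightarrow> 0)"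
      and "P1' \<equiv> \<not> (\<exists>f. almost_disjoint_in UNIV f \<and> (\<lambda>n. norm (T (f n))) \<longlonglongrightarrow> 0)"
      and "P2 \<equiv> (\<forall>f. disjoint_seq f \<and> (\<forall>n. f n \<noteq> 0) \<longrightarrow>
                   \<not> compact_on (closure (span (range f))) T)"
      and "P3 \<equiv> (\<forall>f. disjoint_seq f \<and> (\<forall>n. f n \<noteq> 0) \<longrightarrow>
                   \<not> strictly_singular_on (closure (span (range f))) T)"
      and "P4 \<equiv> (\<forall>f. disjoint_seq f \<and> (\<forall>n. f n \<noteq> 0) \<longrightarrow>
                   upper_semi_fredholm_on (closure (span (range f))) T)"
      and "P5 \<equiv> (\<forall>f. disjoint_seq f \<and> (\<forall>n. f n \<noteq> 0) \<longrightarrow>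
                   (\<exists>m. bounded_below_on (closure (span (f ` {m..}))) T))"
      and "P6 \<equiv> (\<forall>S :: 'f \<Rightarrow> 'e. bounded_linear S \<and> compact_on UNIV S \<longrightarrow>
                   dispersed {x. T x - S x = 0})"
      and "P7 \<equiv> (\<forall>G. closed_subspace G \<and> anti_dispersed G \<longrightarrow> upper_semi_fredholm_on G T)"
      and "P8 \<equiv> (\<forall>G. closed_subspace G \<and> \<not> dispersed G \<longrightarrow> \<not> compact_on G T)"
      and "P9 \<equiv> (\<forall>G. closed_subspace G \<and> \<not> dispersed G \<longrightarrow> \<not> strictly_singular_on G T)"
  shows "(P1 \<longleftrightarrow> P1') \<and> (P1 \<longleftrightarrow> P2) \<and> (P1 \<longleftrightarrow> P3) \<and> (P1 \<longleftrightarrow> P4) \<and> (P1 \<longleftrightarrow> P5) \<and>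
         (P1 \<longleftrightarrow> P6) \<and> (P1 \<longleftrightarrow> P7) \<and> (P1 \<longleftrightarrow> P8) \<and> (P1 \<longleftrightarrow> P9)"
proof -
  have lin: "linear T" using assms(1) by (rule bounded_linear.linear)
  have P1: "P1 \<longleftrightarrow> disjointly_nonsingular T"
    by (simp add: P1_def disjointly_nonsingular_def)
  have cs: "subspace (closure (span (range f)))" for f :: "nat \<Rightarrow> 'f"
    by (simp add: subspace_closure)
  have infinite: "\<not> fin_dim (closure (span (range f)))"
    if "disjoint_seq f" "\<And>n. f n \<noteq> 0" for f :: "nat \<Rightarrow> 'f"
    using disjoint_seq_not_fin_dim[OF that] fin_dim_subset[OF _ closure_subset] by blast
  have nonzero: "\<forall>n. h n \<noteq> 0" if "\<And>n. norm (h n) = 1" for h :: "nat \<Rightarrow> 'f"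
    using that by (metis norm_zero zero_neq_one)
  have P1_P1': "P1 \<Longrightarrow> P1'"
    unfolding P1 P1'_def using disjointly_nonsingular_not_tendsto_0[OF assms(1)] by blast
  have P1'_P1: "P1' \<Longrightarrow> P1"
  proof -
    have "almost_disjoint_in UNIV f" if "\<forall>n. norm (f n) = 1" "disjoint_seq f" for f :: "nat \<Rightarrow> 'f"
      unfolding almost_disjoint_in_def using that by (intro conjI exI[of _ f]) simp_all
    then show "P1' \<Longrightarrow> P1" unfolding P1_def P1'_def by blast
  qed
  have P1_P5: "P1 \<Longrightarrow> P5"
    unfolding P1 P5_def using disjointly_nonsingular_bounded_below_tail[OF assms(1)] by blast
  have P5_P3: "P5 \<Longrightarrow> P3"
    unfolding P3_def
  proof (intro allI impI notI; elim conjE)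
    fix f :: "nat \<Rightarrow> 'f"
    assume P5 and f: "disjoint_seq f" "\<forall>n. f n \<noteq> 0"
      and ss: "strictly_singular_on (closure (span (range f))) T"
    then obtain m where m: "bounded_below_on (closure (span (f ` {m..}))) T"
      unfolding P5_def by blast
    \<comment> \<open>Reindexing the tail as a full sequence lets \<open>infinite\<close> apply to
      it.\<close>
    let ?g = "\<lambda>n. f (n + m)"
    have "disjoint_seq ?g" by (rule disjoint_seq_subseq[OF f(1)]) (simp add: inj_def)
    then have inf: "\<not> fin_dim (closure (span (range ?g)))" by (rule infinite) (simp add: f(2))
    have "range ?g \<subseteq> f ` {m..}" by auto
    then have "closure (span (range ?g)) \<subseteq> closure (span (f ` {m..}))"
      by (intro closure_mono span_mono)
    then have "bounded_below_on (closure (span (range ?g))) T"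
      using m unfolding bounded_below_on_def by blast
    moreover have "closure (span (range ?g)) \<subseteq> closure (span (range f))"
      by (intro closure_mono span_mono) auto
    ultimately show False
      using ss inf cs[of ?g] unfolding strictly_singular_on_def by blast
  qed
  have P3_P2: "P3 \<Longrightarrow> P2"
    unfolding P3_def P2_def using strictly_singular_if_compact[OF lin] by blast
  have P2_P1: "P2 \<Longrightarrow> P1"
  proof (rule ccontr)
    assume P2 "\<not> P1"
    obtain h where "disjoint_seq h" "\<And>n. norm (h n) = 1" "compact_on (closure (span (range h))) T"
      by (rule compact_on_disjoint_if_not_dns[OF assms(1)]) (use \<open>\<not> P1\<close> P1 in simp, rule that)
    then show False using \<open>P2\<close> nonzero[of h] unfolding P2_def by blast
  qed
  have P1_P9: "P1 \<Longrightarrow> P9"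
    unfolding P1 P9_def closed_subspace_def
    using disjointly_nonsingular_not_strictly_singular[OF assms(1)] by blast
  have P9_P8: "P9 \<Longrightarrow> P8"
    unfolding P9_def P8_def using strictly_singular_if_compact[OF lin] by blast
  have P8_P2: "P8 \<Longrightarrow> P2"
    unfolding P2_def
  proof (intro allI impI; elim conjE)
    fix f :: "nat \<Rightarrow> 'f" assume P8 and f: "disjoint_seq f" "\<forall>n. f n \<noteq> 0"
    have "\<not> dispersed (closure (span (range f)))"
      using f(2) by (intro not_dispersed_if_disjoint[OF f(1) _ cs] subsetI in_closure_span) simp_all
    then show "\<not> compact_on (closure (span (range f))) T"
      using \<open>P8\<close> closed_subspace_closure_span unfolding P8_def by blast
  qed
  have P8_P6: "P8 \<Longrightarrow> P6"
    unfolding P6_def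
  proof (intro allI impI; elim conjE)
    fix S :: "'f \<Rightarrow> 'e" assume P8 and S: "bounded_linear S" "compact_on UNIV S"
    interpret D: bounded_linear "\<lambda>x. T x - S x"
      by (intro bounded_linear_sub assms(1) S(1))
    let ?K = "{x. T x - S x = 0}"
    have "closed_subspace ?K"
      unfolding closed_subspace_def
    proof
      show "subspace ?K" by (auto simp: subspace_def D.zero D.add D.scaleR simp del: right_minus_eq)
      show "closed ?K"
        by (rule closed_Collect_eq[OF D.continuous_on[OF continuous_on_id] continuous_on_const])
    qed
    moreover have "compact_on ?K T"
    proof -
      \<comment> \<open>On this kernel \<open>T\<close> coincides with the compact \<open>S\<close>,
        so the restriction of \<open>T\<close> inherits compactness.\<close>
      have "T ` (?K \<inter> cball 0 1) \<subseteq> S ` (UNIV \<inter> cball 0 1)" by auto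
      then show ?thesis
        using S(2) unfolding compact_on_def
        by (meson closure_subset compact_closure_if_subset order_trans)
    qed
    ultimately show "dispersed ?K" using \<open>P8\<close> unfolding P8_def by blast
  qed
  have P6_P1: "P6 \<Longrightarrow> P1"
  proof (rule ccontr)
    assume P6 "\<not> P1"
    obtain S where "bounded_linear S" "compact_on UNIV S" "\<not> dispersed {x. T x - S x = 0}"
      by (rule compact_perturbation_if_not_dns[OF assms(1)]) (use \<open>\<not> P1\<close> P1 in simp, rule that)
    then show False using \<open>P6\<close> unfolding P6_def by blast
  qed
  have P8_P7: "P8 \<Longrightarrow> P7"
    unfolding P7_def
  proof (intro allI impI; elim conjE)
    fix G :: "'f set" assume P8 and G: "closed_subspace G" "anti_dispersed G"
    show "upper_semi_fredholm_on G T"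
    proof (rule ccontr)
      assume "\<not> upper_semi_fredholm_on G T"
      then obtain H where "closed_subspace H" "H \<subseteq> G" "\<not> fin_dim H" "compact_on H T"
        by (rule compact_on_subspace_if_not_fredholm[OF assms(1) G(1)])
      then show False
        using \<open>P8\<close> G(2) unfolding P8_def anti_dispersed_def by blast
    qed
  qed
  have P7_P4: "P7 \<Longrightarrow> P4"
    unfolding P7_def P4_def
    using closed_subspace_closure_span anti_dispersed_closure_span_disjoint by blast
  have P4_P1: "P4 \<Longrightarrow> P1"
  proof (rule ccontr)
    assume P4 "\<not> P1"
    obtain h where h: "disjoint_seq h" "\<And>n. norm (h n) = 1"
        "compact_on (closure (span (range h))) T"
      by (rule compact_on_disjoint_if_not_dns[OF assms(1)]) (use \<open>\<not> P1\<close> P1 in simp, rule that)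
    have "\<not> upper_semi_fredholm_on (closure (span (range h))) T"
      using nonzero[of h] h(2)
      by (intro not_fredholm_if_compact[OF assms(1) cs h(3)] infinite[OF h(1)]) simp
    then show False using \<open>P4\<close> h(1) nonzero[of h] h(2) unfolding P4_def by blast
  qed
  show ?thesis
    using P1_P1' P1'_P1 P1_P5 P5_P3 P3_P2 P2_P1 P1_P9 P9_P8 P8_P2 P8_P6 P6_P1 P8_P7 P7_P4 P4_P1
    by argo
qed

end
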